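(* Fix $\beta\in(0,1)$ and let $G\sim G\!\left(n,1-n^{-(1-\beta)}\right)$. Then, with high probability (i.e. with probability tending to $1$ as $n\to\infty$), $$\frac{2}{\beta}\le \chi_m(G)\le \left\lfloor\frac{2}{\beta}\right\rfloor+5.$$ Consequently, with high probability, $\chi_m(G)=\frac{2}{\beta}+O(1)$.
   Context: $G(n,p)$ is the Erdős–Rényi random graph on $n$ labeled vertices in which each pair is an edge independently with probability $p$. For a finite simple graph $G=(V,E)$, $N_G(v)$ is the open neighborhood of $v$. Given a partition $V=P_1\cup\cdots\cup P_q$, the signature of a vertex $v$ is $\sigma(v)=\bigl(|N_G(v)\cap P_i|\bigr)_{i=1}^q$. The (ordered) partition is a multiset coloring if $\sigma(u)\ne\sigma(v)$ for every edge $uv\in E$. The multiset chromatic number $\chi_m(G)$ is the minimum number $q$ of parts in a multiset coloring of $G$. The $O(1)$ denotes a quantity bounded in absolute value by an absolute constant. *)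

theory Defs
  imports "HOL-Probability.Probability"
begin

text \<open>
  A finite simple graph is given by its vertex set \<open>V\<close> and its set \<open>E\<close> of edges, each edge being a
  two-element subset of \<open>V\<close>.
\<close>

definition all_pairs :: "'a set \<Rightarrow> 'a set set" where
  "all_pairs V = {e. e \<subseteq> V \<and> card e = 2}"

definition neighborhood :: "'a set set \<Rightarrow> 'a \<Rightarrow> 'a set" where
  "neighborhood E v = {u. {u, v} \<in> E}"

definition signature :: "'a set set \<Rightarrow> 'a set list \<Rightarrow> 'a \<Rightarrow> nat list" where
  "signature E Ps v = map (\<lambda>P. card (neighborhood E v \<inter> P)) Ps"

text \<open>
  An ordered partition is a list of pairwise distinct sets whose set of entries is a partition;
  in particular its parts are nonempty.
\<close>

definition ordered_partition :: "'a set \<Rightarrow> 'a set list \<Rightarrow> bool" where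
  "ordered_partition V Ps \<longleftrightarrow> distinct Ps \<and> partition_on V (set Ps)"

definition multiset_coloring :: "'a set \<Rightarrow> 'a set set \<Rightarrow> 'a set list \<Rightarrow> bool" where
  "multiset_coloring V E Ps \<longleftrightarrow>
     ordered_partition V Ps \<and>
     (\<forall>u v. {u, v} \<in> E \<longrightarrow> signature E Ps u \<noteq> signature E Ps v)"

definition multiset_chromatic_number :: "'a set \<Rightarrow> 'a set set \<Rightarrow> nat" where
  "multiset_chromatic_number V E =
     (LEAST q. \<exists>Ps. multiset_coloring V E Ps \<and> length Ps = q)"

text \<open>
  The minimum is over a nonempty set: the partition into singletons is a multiset coloring.
\<close>

lemma ex_multiset_coloring:
  assumes "finite V" "E \<subseteq> all_pairs V"
  shows "\<exists>Ps. multiset_coloring V E Ps"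
proof -
  obtain vs where vs: "set vs = V" "distinct vs"
    using finite_distinct_list[OF assms(1)] by blast
  define Ps where "Ps = map (\<lambda>v. {v}) vs"
  have "distinct Ps"
    using vs by (auto simp: Ps_def distinct_map inj_on_def)
  moreover have "partition_on V (set Ps)"
    using vs by (auto simp: Ps_def partition_on_def disjoint_def)
  moreover have "signature E Ps u \<noteq> signature E Ps v" if e: "{u, v} \<in> E" for u v
  proof
    assume eq: "signature E Ps u = signature E Ps v"
    have "u \<in> V"
      using e assms(2) by (auto simp: all_pairs_def)
    then have "card (neighborhood E u \<inter> {u}) = card (neighborhood E v \<inter> {u})"
      using eq vs by (auto simp: signature_def Ps_def)
    moreover have "u \<notin> neighborhood E u"
      using assms(2) by (auto simp: neighborhood_def all_pairs_def)
    moreover have "u \<in> neighborhood E v"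
      using e by (simp add: neighborhood_def)
    ultimately show False by simp
  qed
  ultimately show ?thesis
    unfolding multiset_coloring_def ordered_partition_def by blast
qed

text \<open>
  The Erdos--Renyi graph \<open>G(n, p)\<close> on the vertex set \<open>{1..n}\<close>, as a distribution on edge sets: every
  pair is kept according to an independent Bernoulli variable.
\<close>

definition gnp :: "nat \<Rightarrow> real \<Rightarrow> nat set set pmf" where
  "gnp n p =
     map_pmf (\<lambda>f. {e \<in> all_pairs {1..n}. f e})
       (Pi_pmf (all_pairs {1..n}) False (\<lambda>_. bernoulli_pmf p))"

end

theory Submission
  imports Defs "HOL-Real_Asymp.Real_Asymp"
begin

text \<open>
  Pass to the complement of \<open>G\<close>, a sparse graph \<open>H\<close> of average degree about \<open>n powr \<beta>\<close>.

  Lower bound: vertices with the same signature form a clique of \<open>H\<close>, so their number is bounded.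
  By a union bound over all pairs \<open>(S, T)\<close> of vertex sets, for every partition at least half of the
  vertices have all their signature entries in windows of length \<open>O(n powr (\<beta> / 2))\<close>. Hence
  \<open>q\<close> parts give \<open>O(n powr (q * \<beta> / 2))\<close> signatures on these vertices, which forces \<open>q \<ge> 2 / \<beta>\<close>.

  Upper bound: colour randomly with \<open>r + 1\<close> colours, \<open>r = floor (2 / \<beta>) + 4\<close>, so that a signature has
  \<open>r\<close> independent entries besides the degree. A pair of vertices of equal degree collides with
  probability \<open>O(n powr (- r * \<beta> / 2))\<close>. Such a pair shares randomness with at most
  \<open>O(n powr (2 * \<beta>) * n powr (1 - \<beta> / 2))\<close> others: a pair is determined by one endpoint, which lies
  within distance two in \<open>H\<close>, and a second vertex of the same degree. As \<open>r > 2 / \<beta> + 3\<close>, the local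
  lemma yields a colouring without collisions.
\<close>

section \<open>Independent coordinates and binomial counts\<close>

text \<open>In the lower bound the partition may be chosen after the graph has been seen, so
  estimates must hold for all 2^n sets \<open>T\<close> at once. A single vertex cannot be
  controlled in this way: taking for \<open>T\<close> its non-neighbours makes its deviation of
  order n^\<beta>. Summed over a set \<open>S\<close> of linear size, a deviation of order |S|
  n^(\<beta>/2) has probability at most 2 exp(-2n), small enough for 4^n pairs. Hence windows of the
  size of the square root of a typical degree, and hence the vertices that must be given up.

  In the upper bound a plain union bound over n^2 pairs would need about 4/\<beta> colours; the
  local lemma counts only pairs that share coins. Restricting to equal degrees cuts the choices of a
  second endpoint from n to n^(1 - \<beta>/2). The gain n^(\<beta>/2) is worth exactly one
  independent entry and so pays for the common colour, whose entry adds no randomness. The number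
  \<open>r\<close> is the least integer above 2/\<beta> + 3.\<close>

lemma prob_Pi_pmf_conj_le:
  fixes p :: "'a \<Rightarrow> 'b pmf"
  assumes "finite A" "B \<subseteq> A"
    and indep: "\<And>y y'. (\<And>x. x \<notin> B \<Longrightarrow> y x = y' x) \<Longrightarrow> Q y = Q y'"
    and fibre: "\<And>z. measure_pmf.prob (Pi_pmf B d p) {b. R (\<lambda>x. if x \<in> B then b x else z x)} \<le> c"
  shows "measure_pmf.prob (Pi_pmf A d p) {y. Q y \<and> R y} \<le>
         c * measure_pmf.prob (Pi_pmf A d p) {y. Q y}"
proof -
  have fin: "finite B" "finite (A - B)"
    using assms finite_subset by auto
  have c: "c \<ge> 0"
    using fibre[of undefined] measure_nonneg order_trans by blast
  define M N where "M = Pi_pmf (A - B) d p" and "N = Pi_pmf B d p"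
  define h where "h = (\<lambda>(f, g) x. if x \<in> A - B then f x else (g x :: 'b))"
  have un: "Pi_pmf A d p = map_pmf h (pair_pmf M N)"
  proof -
    have "A - B \<union> B = A" using assms(2) by blast
    then show ?thesis
      using Pi_pmf_union[of "A - B" B d p] fin unfolding M_def N_def h_def by auto
  qed
  have em: "emeasure (Pi_pmf A d p) X = (\<integral>\<^sup>+f. emeasure N {g. h (f, g) \<in> X} \<partial>M)" for X
  proof -
    have "emeasure (Pi_pmf A d p) X = emeasure (pair_pmf M N) (h -` X)"
      unfolding un by simp
    also have "\<dots> = (\<integral>\<^sup>+x. indicator (h -` X) x \<partial>pair_pmf M N)"
      by simp
    also have "\<dots> = (\<integral>\<^sup>+f. \<integral>\<^sup>+g. indicator {g. h (f, g) \<in> X} g \<partial>N \<partial>M)"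
      unfolding nn_integral_pair_pmf' by (intro nn_integral_cong) (auto simp: indicator_def)
    finally show ?thesis by simp
  qed
  \<comment> \<open>Outside \<open>A\<close> both halves take the default \<open>d\<close>, so
    \<open>h (f, g)\<close> agrees with \<open>f\<close> at every point off \<open>B\<close>,
    including the points off \<open>A\<close>.\<close>
  have N: "g x = d" if "g \<in> set_pmf N" "x \<notin> B" for g x
    using set_Pi_pmf_subset[OF fin(1), of d p] that unfolding N_def by auto
  have Qh: "Q (h (f, g)) = Q f" if f: "f \<in> set_pmf M" "g \<in> set_pmf N" for f g
  proof (rule indep)
    show "h (f, g) x = f x" if "x \<notin> B" for x
      using set_Pi_pmf_subset[OF fin(2), of d p] that f N[OF f(2) that] unfolding M_def h_def
      by auto
  qed
  have R: "emeasure N {g. R (h (f, g))} \<le> ennreal c" if f: "f \<in> set_pmf M" for f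
  proof -
    have "h (f, g) = (\<lambda>x. if x \<in> B then g x else f x)" if "g \<in> set_pmf N" for g
      using set_Pi_pmf_subset[OF fin(2), of d p] that f N[OF that] unfolding M_def h_def
      by (auto simp: fun_eq_iff)
    then have "measure N {g. R (h (f, g))} = measure N {b. R (\<lambda>x. if x \<in> B then b x else f x)}"
      by (intro measure_pmf.finite_measure_eq_AE) (auto simp: AE_measure_pmf_iff)
    also have "\<dots> \<le> c"
      using fibre unfolding N_def .
    finally show ?thesis
      by (simp add: measure_pmf.emeasure_eq_measure c)
  qed
  \<comment> \<open>Fubini: once the half \<open>f\<close> is fixed, \<open>Q\<close> is almost
    surely constant and \<open>R\<close> has probability at most \<open>c\<close>, so the bound
    holds for each inner integral.\<close>
  have "emeasure (Pi_pmf A d p) {y. Q y \<and> R y} = (\<integral>\<^sup>+f. emeasure N {g. Q (h (f, g)) \<and> R (h (f, g))} \<partial>M)"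
    unfolding em by simp
  also have "\<dots> \<le> (\<integral>\<^sup>+f. ennreal c * emeasure N {g. Q (h (f, g))} \<partial>M)"
  proof (intro nn_integral_mono_AE, unfold AE_measure_pmf_iff, intro ballI)
    fix f assume f: "f \<in> set_pmf M"
    show "emeasure N {g. Q (h (f, g)) \<and> R (h (f, g))} \<le> ennreal c * emeasure N {g. Q (h (f, g))}"
    proof (cases "Q f")
      case True
      have "emeasure N {g. Q (h (f, g))} = emeasure N UNIV"
        by (rule emeasure_eq_AE) (auto simp: AE_measure_pmf_iff Qh f True)
      moreover have "emeasure N {g. Q (h (f, g)) \<and> R (h (f, g))} \<le> emeasure N {g. R (h (f, g))}"
        by (intro emeasure_mono) auto
      ultimately show ?thesis
        using R[OF f] by (auto simp: measure_pmf.emeasure_eq_1_AE measure_pmf.emeasure_space_1[simplified])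
    next
      case False
      have "emeasure N {g. Q (h (f, g)) \<and> R (h (f, g))} = emeasure N {}"
        by (rule emeasure_eq_AE) (auto simp: AE_measure_pmf_iff Qh f False)
      then show ?thesis by simp
    qed
  qed
  also have "\<dots> = ennreal c * emeasure (Pi_pmf A d p) {y. Q y}"
    unfolding em by (simp add: nn_integral_cmult)
  finally have "ennreal (measure_pmf.prob (Pi_pmf A d p) {y. Q y \<and> R y}) \<le>
      ennreal (c * measure_pmf.prob (Pi_pmf A d p) {y. Q y})"
    by (simp add: measure_pmf.emeasure_eq_measure c ennreal_mult)
  then show ?thesis
    by (subst (asm) ennreal_le_iff) (simp_all add: c)
qed

lemma prob_Pi_pmf_restrict_coords:
  assumes "finite A" "B \<subseteq> A"
    and dep: "\<And>y y'. (\<And>x. x \<in> B \<Longrightarrow> y x = y' x) \<Longrightarrow> R y = R y'"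
  shows "measure_pmf.prob (Pi_pmf A d p) {y. R y} = measure_pmf.prob (Pi_pmf B d p) {y. R y}"
proof -
  have "measure_pmf.prob (Pi_pmf B d p) {y. R y} =
    measure_pmf.prob (Pi_pmf A d p) ((\<lambda>f x. if x \<in> B then f x else d) -` {y. R y})"
    by (subst Pi_pmf_subset[OF assms(1,2)]) simp
  also have "(\<lambda>f x. if x \<in> B then f x else d) -` {y. R y} = {y. R y}"
    by (auto cong: dep)
  finally show ?thesis by simp
qed

text \<open>When \<open>R\<close> reads only \<open>B\<close>, all its fibre probabilities coincide
  with its total probability. This inequality is the half of independence that the local lemma
  uses.\<close>

lemma prob_Pi_pmf_indep_le:
  assumes "finite A" "B \<subseteq> A"
    and Q: "\<And>y y'. (\<And>x. x \<notin> B \<Longrightarrow> y x = y' x) \<Longrightarrow> Q y = Q y'"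
    and R: "\<And>y y'. (\<And>x. x \<in> B \<Longrightarrow> y x = y' x) \<Longrightarrow> R y = R y'"
  shows "measure_pmf.prob (Pi_pmf A d p) {y. Q y \<and> R y} \<le>
         measure_pmf.prob (Pi_pmf A d p) {y. R y} * measure_pmf.prob (Pi_pmf A d p) {y. Q y}"
proof (rule prob_Pi_pmf_conj_le[OF assms(1,2) Q])
  fix z
  have "{b. R (\<lambda>x. if x \<in> B then b x else z x)} = {b. R b}"
    by (auto cong: R)
  then show "measure_pmf.prob (Pi_pmf B d p) {b. R (\<lambda>x. if x \<in> B then b x else z x)}
    \<le> measure_pmf.prob (Pi_pmf A d p) {y. R y}"
    using prob_Pi_pmf_restrict_coords[where R = R and d = d and p = p, OF assms(1,2) R] by simp
qed

section \<open>Point probabilities of binomial counts\<close>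

text \<open>Multiplied out, the ratio of consecutive probabilities also makes sense for
  \<open>k \<ge> m\<close>, where both sides vanish. It serves twice: it locates the mode and bounds
  the decay to the right of it.\<close>

lemma pmf_binomial_ratio:
  assumes "0 < p" "p < (1::real)"
  shows "pmf (binomial_pmf m p) (Suc k) * (real k + 1) * (1 - p) =
    pmf (binomial_pmf m p) k * (real m - real k) * p"
proof (cases "k < m")
  case True
  then have mk: "m - k = Suc (m - Suc k)" by simp
  have "(m choose Suc k) * Suc k = (m choose k) * (m - k)"
    by (metis binomial_absorb_comp binomial_absorption mult.commute)
  then have choose: "real (m choose Suc k) * (real k + 1) = real (m choose k) * (real m - real k)"
    using True by (metis of_nat_mult of_nat_Suc of_nat_diff less_imp_le add.commute)
  have "pmf (binomial_pmf m p) (Suc k) * (real k + 1) * (1 - p) =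
      real (m choose Suc k) * (real k + 1) * (p * p ^ k * ((1 - p) * (1 - p) ^ (m - Suc k)))"
    using assms by simp
  also have "\<dots> = real (m choose k) * (real m - real k) * (p * p ^ k * ((1 - p) * (1 - p) ^ (m - Suc k)))"
    by (simp only: choose)
  also have "\<dots> = pmf (binomial_pmf m p) k * (real m - real k) * p"
    using assms by (simp add: mk)
  finally show ?thesis .
next
  case False
  then consider "k = m" | "k > m" by linarith
  then show ?thesis
    using assms by cases (auto simp: binomial_eq_0)
qed

text \<open>Near its mode the distribution stays above half of its maximum for about \<open>sqrt (m p / 2)\<close>
  steps, and the total mass is one.\<close>

lemma pmf_binomial_le:
  assumes p: "0 < p" "p \<le> 1/2" and m: "m > 0"
  shows "pmf (binomial_pmf m p) k \<le> 6 / sqrt (real m * p)"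
proof (cases "real m * p < 2")
  case True
  \<comment> \<open>For a small mean the bound exceeds 1. In the other case the mean is at least 2,
    which makes the run length \<open>J\<close> positive.\<close>
  have "sqrt (real m * p) \<le> sqrt 36" using True by (intro real_sqrt_le_mono) auto
  then have "sqrt (real m * p) \<le> 6" by simp
  then have "1 \<le> 6 / sqrt (real m * p)"
    using p m by (simp add: field_simps)
  then show ?thesis
    using pmf_le_1[of "binomial_pmf m p" k] by linarith
next
  case False
  define b where "b = pmf (binomial_pmf m p)"
  have b0: "b k = 0" if "k > m" for k
    using p that by (simp add: b_def binomial_eq_0)
  have bnn: "b k \<ge> 0" for k by (simp add: b_def)
  have "finite (b ` {..m})" "b ` {..m} \<noteq> {}" by auto
  then obtain k0 where k0: "k0 \<le> m" "b k0 = Max (b ` {..m})"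
    by (metis (mono_tags, lifting) Max_in image_iff atMost_iff)
  have mx: "b k \<le> b k0" for k
  proof (cases "k \<le> m")
    case True then show ?thesis unfolding k0(2) by (intro Max_ge) auto
  qed (use b0[of k] bnn in auto)
  have ratio: "b (Suc k) * (real k + 1) * (1 - p) = b k * (real m - real k) * p" for k
    unfolding b_def by (rule pmf_binomial_ratio) (use p in auto)
  have bpos: "b k0 > 0"
  proof (rule ccontr)
    assume "\<not> b k0 > 0"
    then have "b k = 0" for k using mx[of k] bnn[of k] by linarith
    then have "set_pmf (binomial_pmf m p) = {}" by (auto simp: set_pmf_eq b_def)
    then show False by (simp add: set_pmf_not_empty)
  qed
  \<comment> \<open>Comparing the maximum with its right neighbour gives \<open>lo\<close>, with its
    left neighbour \<open>hi\<close>: the mode lies between m p + p - 1 and m p + p.\<close>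
  have lo: "real k0 + 1 \<ge> real m * p + p"
  proof -
    have "b (Suc k0) * ((real k0 + 1) * (1 - p)) \<le> b k0 * ((real k0 + 1) * (1 - p))"
      using mx[of "Suc k0"] p by (intro mult_right_mono) auto
    then have "b k0 * ((real m - real k0) * p) \<le> b k0 * ((real k0 + 1) * (1 - p))"
      using ratio[of k0] unfolding mult.assoc by linarith
    then have "(real m - real k0) * p \<le> (real k0 + 1) * (1 - p)"
      using bpos by simp
    then show ?thesis by (simp add: algebra_simps)
  qed
  have hi: "real k0 \<le> real m * p + p"
  proof (cases k0)
    case (Suc j)
    have "b k0 * ((real m - real j) * p) \<ge> b j * ((real m - real j) * p)"
      using mx[of j] p k0(1) Suc by (intro mult_right_mono) auto
    then have "b k0 * ((real j + 1) * (1 - p)) \<le> b k0 * ((real m - real j) * p)"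
      using ratio[of j] unfolding mult.assoc Suc by linarith
    then have "(real j + 1) * (1 - p) \<le> (real m - real j) * p"
      using bpos by simp
    then show ?thesis using Suc by (simp add: algebra_simps)
  qed (use p in auto)
  define \<mu> where "\<mu> = real m * p"
  have \<mu>: "\<mu> \<ge> 2" using False by (simp add: \<mu>_def)
  \<comment> \<open>One step to the right of the mode loses a relative amount of at most
    2(j+1)/\<mu>; here \<open>p \<le> 1/2\<close> enters through
    \<open>D \<ge> \<mu> / 2\<close>.\<close>
  have step: "b (Suc (k0 + j)) \<ge> b (k0 + j) * (1 - 2 * (real j + 1) / \<mu>)" for j
  proof -
    define D where "D = (real (k0 + j) + 1) * (1 - p)"
    have "D \<ge> (real k0 + 1) * (1 - p)"
      unfolding D_def using p by (intro mult_right_mono) auto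
    also have "(real k0 + 1) * (1 - p) \<ge> \<mu> * (1/2)"
      using lo p \<mu>_def by (intro mult_mono) auto
    finally have D: "D \<ge> \<mu> / 2" by simp
    have "(real m - real (k0 + j)) * p = D - (real (k0 + j) + 1 - p - \<mu>)"
      by (simp add: D_def \<mu>_def algebra_simps)
    also have "\<dots> \<ge> D - (real j + 1)"
      using hi \<mu>_def by auto
    finally have "(real m - real (k0 + j)) * p \<ge> D - (real j + 1)" .
    moreover have "D * (1 - 2 * (real j + 1) / \<mu>) \<le> D - (real j + 1)"
    proof -
      have "real j + 1 \<le> D * (2 * (real j + 1) / \<mu>)"
      proof -
        have "(\<mu> / 2) * (2 * (real j + 1) / \<mu>) = real j + 1" using \<mu> by (simp add: field_simps)
        moreover have "(\<mu> / 2) * (2 * (real j + 1) / \<mu>) \<le> D * (2 * (real j + 1) / \<mu>)"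
          using D \<mu> by (intro mult_right_mono) auto
        ultimately show ?thesis by linarith
      qed
      then show ?thesis by (simp add: right_diff_distrib)
    qed
    ultimately have "b (k0 + j) * (D * (1 - 2 * (real j + 1) / \<mu>)) \<le> b (k0 + j) * ((real m - real (k0 + j)) * p)"
      using bnn by (intro mult_left_mono) auto
    also have "\<dots> = b (Suc (k0 + j)) * D"
      using ratio[of "k0 + j"] by (simp add: D_def mult.assoc)
    finally have "(b (k0 + j) * (1 - 2 * (real j + 1) / \<mu>)) * D \<le> b (Suc (k0 + j)) * D"
      by (simp add: mult_ac)
    then show ?thesis
      by (rule mult_right_le_imp_le) (use D \<mu> in auto)
  qed
  \<comment> \<open>The losses of the first j steps add up to j(j+1)/\<mu>, which is at most 1/2 as
    long as \<open>j < J\<close>.\<close>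
  define J where "J = nat \<lfloor>sqrt (\<mu> / 2)\<rfloor>"
  have s1: "sqrt (\<mu> / 2) \<ge> 1" using \<mu> by simp
  have J: "real J \<le> sqrt (\<mu> / 2)" "real J \<ge> sqrt (\<mu> / 2) / 2" "J \<ge> 1"
  proof -
    have f: "\<lfloor>sqrt (\<mu> / 2)\<rfloor> \<ge> 1" using s1 by (simp add: le_floor_iff)
    then have "real J = of_int \<lfloor>sqrt (\<mu> / 2)\<rfloor>" unfolding J_def by simp
    then show "real J \<le> sqrt (\<mu> / 2)" "real J \<ge> sqrt (\<mu> / 2) / 2" using f by linarith+
    show "J \<ge> 1" using f unfolding J_def by linarith
  qed
  have J2: "real J * real J \<le> \<mu> / 2"
    using mult_mono[OF J(1) J(1)] \<mu> by auto
  have jb: "real j * (real j + 1) \<le> \<mu> / 2" if "j < J" for j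
  proof -
    have "real j * (real j + 1) \<le> real J * real J" using that by (intro mult_mono) auto
    then show ?thesis using J2 by simp
  qed
  have low: "b (k0 + j) \<ge> b k0 * (1 - real j * (real j + 1) / \<mu>)" if "j < J" for j
    using that
  proof (induction j)
    case (Suc j)
    define x y where "x = real j * (real j + 1) / \<mu>" and "y = 2 * (real j + 1) / \<mu>"
    have xy: "x \<ge> 0" "y \<ge> 0" using \<mu> by (auto simp: x_def y_def)
    have sum: "real (Suc j) * (real (Suc j) + 1) / \<mu> = x + y"
      using \<mu> by (simp add: x_def y_def field_simps)
    have "x + y \<le> 1/2" using jb[OF Suc.prems] \<mu> unfolding sum[symmetric] by (simp add: field_simps)
    then have "y \<le> 1" using xy by linarith
    moreover have "b k0 * (1 - x) \<le> b (k0 + j)" using Suc by (simp add: x_def)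
    ultimately have "b k0 * (1 - x) * (1 - y) \<le> b (k0 + j) * (1 - y)"
      by (intro mult_right_mono) auto
    also have "\<dots> \<le> b (k0 + Suc j)"
      using step[of j] by (simp add: y_def)
    finally have "b k0 * ((1 - x) * (1 - y)) \<le> b (k0 + Suc j)" by (simp add: mult.assoc)
    moreover have "b k0 * (1 - (x + y)) \<le> b k0 * ((1 - x) * (1 - y))"
      using bpos xy by (intro mult_left_mono) (auto simp: algebra_simps)
    ultimately show ?case unfolding sum by linarith
  qed auto
  have half: "b (k0 + j) \<ge> b k0 / 2" if "j < J" for j
  proof -
    have "real j * (real j + 1) / \<mu> \<le> 1/2" using jb[OF that] \<mu> by (simp add: field_simps)
    then have "b k0 * (1 - real j * (real j + 1) / \<mu>) \<ge> b k0 * (1/2)"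
      using bpos by (intro mult_left_mono) auto
    then have "b k0 / 2 \<le> b k0 * (1 - real j * (real j + 1) / \<mu>)" by simp
    then show ?thesis using low[OF that] by (rule order_trans)
  qed
  have "real J * (b k0 / 2) \<le> (\<Sum>j<J. b (k0 + j))"
    using sum_mono[of "{..<J}" "\<lambda>_. b k0 / 2" "\<lambda>j. b (k0 + j)"] half by auto
  also have "\<dots> = sum b ((+) k0 ` {..<J})"
    by (subst sum.reindex) auto
  also have "\<dots> = measure_pmf.prob (binomial_pmf m p) ((+) k0 ` {..<J})"
    unfolding b_def by (rule measure_measure_pmf_finite[symmetric]) auto
  also have "\<dots> \<le> 1" by simp
  \<comment> \<open>With J at least sqrt(\<mu>/2)/2 the maximum is at most 4 sqrt 2 / sqrt \<mu>,
    and 4 sqrt 2 is rounded up to 6.\<close>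
  finally have "real J * b k0 \<le> 2" by simp
  moreover have "sqrt (\<mu> / 2) / 2 * b k0 \<le> real J * b k0"
    using J bpos by (intro mult_right_mono) auto
  ultimately have "sqrt (\<mu> / 2) * b k0 \<le> 4" by simp
  then have "sqrt \<mu> * b k0 \<le> 4 * sqrt 2"
    by (simp add: real_sqrt_divide field_simps)
  also have "\<dots> \<le> 6"
  proof -
    have "sqrt 2 \<le> sqrt ((3/2)\<^sup>2)" by (intro real_sqrt_le_mono) (simp add: power2_eq_square)
    then show ?thesis by simp
  qed
  finally have "b k0 \<le> 6 / sqrt \<mu>" using \<mu> by (simp add: field_simps)
  then show ?thesis using mx[of k] unfolding b_def \<mu>_def by linarith
qed

text \<open>The target \<open>k\<close> is an integer because later targets are differences of
  counts and may be negative; a negative target has probability 0.\<close>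

lemma prob_card_eq_le:
  assumes "finite B" "B \<noteq> {}" "0 < p" "p \<le> 1/2"
  shows "measure_pmf.prob (Pi_pmf B d (\<lambda>_. bernoulli_pmf p)) {y. int (card {e \<in> B. y e}) = k}
    \<le> 6 / sqrt (real (card B) * p)"
proof (cases "k \<ge> 0")
  case True
  have "measure_pmf.prob (Pi_pmf B d (\<lambda>_. bernoulli_pmf p)) {y. int (card {e \<in> B. y e}) = k} =
    measure_pmf.prob (map_pmf (\<lambda>f. card {x\<in>B. f x}) (Pi_pmf B d (\<lambda>_. bernoulli_pmf p))) {nat k}"
    using True by (auto intro!: arg_cong[where f = "measure _"])
  also have "\<dots> = pmf (binomial_pmf (card B) p) (nat k)"
    by (subst binomial_pmf_altdef'[symmetric]) (use assms in \<open>auto simp: measure_pmf_single\<close>)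
  also have "\<dots> \<le> 6 / sqrt (real (card B) * p)"
    by (rule pmf_binomial_le) (use assms in \<open>auto simp: card_gt_0_iff\<close>)
  finally show ?thesis .
next
  case False
  then have "{y. int (card {e \<in> B. y e}) = k} = {}" by auto
  then show ?thesis using assms by auto
qed

text \<open>The targets \<open>g v\<close> may depend on the coordinates outside all blocks, so conditionally on these
  the counts are independent binomial variables.\<close>

lemma prob_block_counts_le:
  assumes "finite A" "finite S" "disjoint_family_on B S"
    and B: "\<And>v. v \<in> S \<Longrightarrow> B v \<subseteq> A" "\<And>v. v \<in> S \<Longrightarrow> real (card (B v)) \<ge> m"
    and m: "m > 0" and p: "0 < p" "p \<le> 1/2"
    and g: "\<And>v y y'. v \<in> S \<Longrightarrow> (\<And>x. x \<notin> (\<Union>w\<in>S. B w) \<Longrightarrow> y x = y' x) \<Longrightarrow> g v y = g v y'"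
  shows "measure_pmf.prob (Pi_pmf A d (\<lambda>_. bernoulli_pmf p))
      {y. \<forall>v\<in>S. int (card {e \<in> B v. y e}) = g v y} \<le> (6 / sqrt (m * p)) ^ card S"
  using assms(2,3) B g
proof (induction S rule: finite_induct)
  case (insert a S)
  let ?P = "measure_pmf.prob (Pi_pmf A d (\<lambda>_. bernoulli_pmf p))"
  let ?c = "6 / sqrt (m * p)"
  define Q where "Q = (\<lambda>y. \<forall>v\<in>S. int (card {e \<in> B v. y e}) = g v y)"
  have disj: "B a \<inter> B v = {}" if "v \<in> S" for v
    using insert.prems(1) insert.hyps(2) that unfolding disjoint_family_on_def by (metis insertI1 insertI2)
  have fB: "finite (B a)" "real (card (B a)) \<ge> m"
    using insert.prems(2,3) finite_subset[OF _ assms(1)] by auto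
  \<comment> \<open>The block of \<open>a\<close> is sampled last: the other counts and all targets
    ignore it, so what remains is a binomial point probability.\<close>
  have "?P {y. Q y \<and> int (card {e \<in> B a. y e}) = g a y} \<le> ?c * ?P {y. Q y}"
  proof (rule prob_Pi_pmf_conj_le[OF assms(1)])
    show "B a \<subseteq> A" using insert.prems(2) by auto
    fix y y' :: "'a \<Rightarrow> bool" assume y: "\<And>x. x \<notin> B a \<Longrightarrow> y x = y' x"
    have "{e \<in> B v. y e} = {e \<in> B v. y' e}" if "v \<in> S" for v
      using disj[OF that] y by blast
    moreover have "g v y = g v y'" if "v \<in> S" for v
      using that y by (intro insert.prems(4)) auto
    ultimately show "Q y = Q y'" unfolding Q_def by auto
  next
    fix z :: "'a \<Rightarrow> bool"
    have "g a (\<lambda>x. if x \<in> B a then b x else z x) = g a z" for b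
      by (rule insert.prems(4)) auto
    moreover have "{e \<in> B a. if e \<in> B a then b e else z e} = {e \<in> B a. b e}" for b
      by auto
    ultimately have "measure_pmf.prob (Pi_pmf (B a) d (\<lambda>_. bernoulli_pmf p))
      {b. int (card {e \<in> B a. if e \<in> B a then b e else z e}) = g a (\<lambda>x. if x \<in> B a then b x else z x)}
      = measure_pmf.prob (Pi_pmf (B a) d (\<lambda>_. bernoulli_pmf p)) {b. int (card {e \<in> B a. b e}) = g a z}"
      by simp
    also have "\<dots> \<le> 6 / sqrt (real (card (B a)) * p)"
      by (rule prob_card_eq_le) (use fB p m in auto)
    also have "\<dots> \<le> ?c"
      using fB m p by (intro divide_left_mono real_sqrt_le_mono mult_right_mono mult_pos_pos) auto
    finally show "measure_pmf.prob (Pi_pmf (B a) d (\<lambda>_. bernoulli_pmf p))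
      {b. int (card {e \<in> B a. if e \<in> B a then b e else z e}) = g a (\<lambda>x. if x \<in> B a then b x else z x)}
      \<le> ?c" .
  qed
  also have "?P {y. Q y} \<le> ?c ^ card S"
    unfolding Q_def
  proof (rule insert.IH)
    show "disjoint_family_on B S"
      using insert.prems(1) by (auto simp: disjoint_family_on_def)
    show "g v y = g v y'" if "v \<in> S" "\<And>x. x \<notin> (\<Union>w\<in>S. B w) \<Longrightarrow> y x = y' x" for v y y'
      using that by (intro insert.prems(4)) auto
  qed (use insert.prems in auto)
  finally have "?P {y. Q y \<and> int (card {e \<in> B a. y e}) = g a y} \<le> ?c ^ card (insert a S)"
    using insert.hyps m p mult_left_mono[of _ _ ?c] by (force intro: order_trans)
  moreover have "{y. \<forall>v\<in>insert a S. int (card {e \<in> B v. y e}) = g v y} =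
      {y. Q y \<and> int (card {e \<in> B a. y e}) = g a y}"
    unfolding Q_def by auto
  ultimately show ?case by simp
qed auto

section \<open>The local lemma and deterministic bounds\<close>

text \<open>The claim \<open>main\<close> says that conditioning on the avoidance of the events in
  \<open>S\<close> at most doubles \<open>c\<close>. It is written as a product because positivity
  of the conditioning event is only derived afterwards. The constant 4 supplies one factor 2 for
  this doubling and one for the union bound over neighbouring events.\<close>

lemma lovasz_local_lemma:
  fixes p :: "'a \<Rightarrow> 'b pmf" and Bad :: "'i \<Rightarrow> ('a \<Rightarrow> 'b) \<Rightarrow> bool" and c k :: real
  assumes fin: "finite A" "finite I"
    and F: "\<And>i. i \<in> I \<Longrightarrow> F i \<subseteq> A"
    and dep: "\<And>i y y'. i \<in> I \<Longrightarrow> (\<And>x. x \<in> F i \<Longrightarrow> y x = y' x) \<Longrightarrow> Bad i y = Bad i y'"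
    and prob: "\<And>i. i \<in> I \<Longrightarrow> measure_pmf.prob (Pi_pmf A d p) {y. Bad i y} \<le> c"
    and deg: "\<And>i. i \<in> I \<Longrightarrow> real (card {j \<in> I. F i \<inter> F j \<noteq> {}}) \<le> k"
    and ck: "c \<ge> 0" "k \<ge> 1" "4 * c * k \<le> 1"
  shows "\<exists>y. \<forall>i\<in>I. \<not> Bad i y"
proof -
  let ?P = "measure_pmf.prob (Pi_pmf A d p)"
  define G where "G = (\<lambda>S y. \<forall>j\<in>S. \<not> Bad j y)"
  have finS: "finite S" if "S \<subseteq> I" for S
    using that fin(2) finite_subset by blast
  have main: "?P {y. Bad i y \<and> G S y} \<le> 2 * c * ?P {y. G S y}" if "S \<subseteq> I" "i \<in> I" for S i
    using that
  proof (induction "card S" arbitrary: S i rule: less_induct)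
    case less
    \<comment> \<open>Events in \<open>S2\<close> read no coordinate of \<open>F i\<close> and are
      independent of \<open>Bad i\<close>; those in \<open>S1\<close> are dropped and paid for by a
      factor 2.\<close>
    define S1 S2 where "S1 = {j \<in> S. F i \<inter> F j \<noteq> {}}" and "S2 = {j \<in> S. F i \<inter> F j = {}}"
    have S: "S = S1 \<union> S2" by (auto simp: S1_def S2_def)
    have fS: "finite S" using finS less.prems by auto
    have "?P {y. Bad i y \<and> G S y} \<le> ?P {y. G S2 y \<and> Bad i y}"
      by (rule measure_pmf.finite_measure_mono) (auto simp: G_def S)
    also have "\<dots> \<le> ?P {y. Bad i y} * ?P {y. G S2 y}"
    proof (rule prob_Pi_pmf_indep_le[OF fin(1) F[OF less.prems(2)] _ dep[OF less.prems(2)]])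
      fix y y' assume y: "\<And>x. x \<notin> F i \<Longrightarrow> y x = (y' x :: 'b)"
      have "Bad j y = Bad j y'" if "j \<in> S2" for j
        using that less.prems by (intro dep) (auto simp: S2_def intro!: y)
      then show "G S2 y = G S2 y'" by (auto simp: G_def)
    qed
    also have "\<dots> \<le> c * ?P {y. G S2 y}"
      by (intro mult_right_mono prob less.prems) auto
    finally have 1: "?P {y. Bad i y \<and> G S y} \<le> c * ?P {y. G S2 y}" .
    have "?P {y. G S2 y} \<le> 2 * ?P {y. G S y}"
    proof (cases "S1 = {}")
      case True
      then show ?thesis by (simp add: S)
    next
      case False
      then have "S2 \<subset> S" by (auto simp: S1_def S2_def)
      then have c2: "card S2 < card S" using fS psubset_card_mono by blast
      \<comment> \<open>By induction each event of \<open>S1\<close> occurs with conditional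
        probability at most 2c given \<open>S2\<close>. Since 2ck is at most 1/2, avoiding all of
        them as well keeps at least half of the probability.\<close>
      have "?P {y. G S2 y} \<le> ?P ({y. G S y} \<union> (\<Union>j\<in>S1. {y. Bad j y \<and> G S2 y}))"
        by (rule measure_pmf.finite_measure_mono) (auto simp: G_def S)
      also have "\<dots> \<le> ?P {y. G S y} + ?P (\<Union>j\<in>S1. {y. Bad j y \<and> G S2 y})"
        by (rule measure_Un_le) auto
      also have "?P (\<Union>j\<in>S1. {y. Bad j y \<and> G S2 y}) \<le> (\<Sum>j\<in>S1. ?P {y. Bad j y \<and> G S2 y})"
        using fS by (intro measure_UNION_le) (auto simp: S1_def)
      also have "\<dots> \<le> (\<Sum>j\<in>S1. 2 * c * ?P {y. G S2 y})"
        using less.prems by (intro sum_mono less.hyps c2) (auto simp: S1_def S2_def)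
      also have "\<dots> = real (card S1) * (2 * c * ?P {y. G S2 y})" by simp
      also have "\<dots> \<le> k * (2 * c * ?P {y. G S2 y})"
      proof (intro mult_right_mono)
        have "card S1 \<le> card {j \<in> I. F i \<inter> F j \<noteq> {}}"
          using less.prems fin(2) by (intro card_mono) (auto simp: S1_def)
        then show "real (card S1) \<le> k" using deg[OF less.prems(2)] by simp
      qed (use ck in auto)
      also have "\<dots> = (4 * c * k) * (?P {y. G S2 y} / 2)" by simp
      also have "\<dots> \<le> 1 * (?P {y. G S2 y} / 2)"
        by (intro mult_right_mono ck) auto
      finally show ?thesis by simp
    qed
    then show ?case using 1 mult_left_mono[of "?P {y. G S2 y}" "2 * ?P {y. G S y}" c] ck
      by (simp add: mult_ac)
  qed
  \<comment> \<open>Each further avoided event removes at most half of the remaining probability, so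
    it stays positive through all of \<open>I\<close>.\<close>
  have c: "2 * c \<le> 1/2"
  proof -
    have "4 * c * 1 \<le> 4 * c * k" using ck by (intro mult_left_mono) auto
    then show ?thesis using ck by simp
  qed
  have "?P {y. G S y} > 0" if "S \<subseteq> I" for S
    using finS[OF that] that
  proof (induction S rule: finite_induct)
    case empty
    then show ?case by (simp add: G_def)
  next
    case (insert i S)
    have "?P {y. G S y} \<le> ?P ({y. G (insert i S) y} \<union> {y. Bad i y \<and> G S y})"
      by (rule measure_pmf.finite_measure_mono) (auto simp: G_def)
    also have "\<dots> \<le> ?P {y. G (insert i S) y} + ?P {y. Bad i y \<and> G S y}"
      by (rule measure_Un_le) auto
    also have "?P {y. Bad i y \<and> G S y} \<le> 2 * c * ?P {y. G S y}"
      using insert.prems by (intro main) auto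
    also have "\<dots> \<le> 1/2 * ?P {y. G S y}"
      by (intro mult_right_mono c) auto
    finally show ?case using insert by simp
  qed
  from this[of I] have "{y. G I y} \<noteq> {}" by force
  then show ?thesis by (auto simp: G_def)
qed

section \<open>Deterministic criteria for upper and lower bounds\<close>

text \<open>Empty colour classes are harmless: they are dropped, and every signature loses a zero.\<close>

lemma multiset_chromatic_number_le:
  fixes col :: "'a \<Rightarrow> nat"
  assumes "finite V" "E \<subseteq> all_pairs V"
    and col: "\<And>v. v \<in> V \<Longrightarrow> col v < q"
    and dist: "\<And>u v. {u, v} \<in> E \<Longrightarrow>
      \<exists>i<q. card {w \<in> neighborhood E u. col w = i} \<noteq> card {w \<in> neighborhood E v. col w = i}"
  shows "multiset_chromatic_number V E \<le> q"
proof -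
  define L where "L = filter (\<lambda>i. \<exists>v\<in>V. col v = i) [0..<q]"
  define Ps where "Ps = map (\<lambda>i. {v\<in>V. col v = i}) L"
  have "distinct Ps"
    unfolding Ps_def distinct_map
    by (auto simp: L_def inj_on_def)
  moreover have "partition_on V (set Ps)"
    unfolding partition_on_def disjoint_def Ps_def L_def using col by auto
  moreover have "signature E Ps u \<noteq> signature E Ps v" if e: "{u, v} \<in> E" for u v
  proof
    assume eq: "signature E Ps u = signature E Ps v"
    obtain i where i: "i < q" "card {w \<in> neighborhood E u. col w = i} \<noteq> card {w \<in> neighborhood E v. col w = i}"
      using dist[OF e] by auto
    have N: "neighborhood E w \<subseteq> V" for w
      using assms(2) by (auto simp: neighborhood_def all_pairs_def)
    have eqN: "{w \<in> neighborhood E x. col w = i} = neighborhood E x \<inter> {v\<in>V. col v = i}" for x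
      using N[of x] by auto
    have "\<exists>v\<in>V. col v = i"
    proof (rule ccontr)
      assume "\<not> ?thesis"
      then have "{v\<in>V. col v = i} = {}" by auto
      then show False using i(2) unfolding eqN by (simp only: Int_empty_right)
    qed
    then have "i \<in> set L" using i by (auto simp: L_def)
    then have "card (neighborhood E u \<inter> {v\<in>V. col v = i}) = card (neighborhood E v \<inter> {v\<in>V. col v = i})"
      using eq unfolding signature_def Ps_def by (auto simp: map_eq_conv)
    then show False using i(2) unfolding eqN by simp
  qed
  ultimately have "multiset_coloring V E Ps"
    unfolding multiset_coloring_def ordered_partition_def by blast
  then have "multiset_chromatic_number V E \<le> length Ps"
    unfolding multiset_chromatic_number_def by (intro Least_le) auto
  also have "\<dots> \<le> q"
    unfolding Ps_def L_def using length_filter_le[of _ "[0..<q]"] by simp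
  finally show ?thesis .
qed

lemma ex_coloring_of_chromatic_number:
  assumes "finite V" "E \<subseteq> all_pairs V"
  obtains Ps where "multiset_coloring V E Ps" "length Ps = multiset_chromatic_number V E"
  using LeastI_ex[of "\<lambda>q. \<exists>Ps. multiset_coloring V E Ps \<and> length Ps = q"]
    ex_multiset_coloring[OF assms] unfolding multiset_chromatic_number_def by blast

text \<open>For \<open>v\<close> in \<open>V\<close> and a loopless graph this is the closed
  neighbourhood of \<open>v\<close> in the complement. These sets are small, and on a fixed colour
  class a count in the neighbourhood and a count in this set determine each other.\<close>

definition nonneighborhood :: "'a set \<Rightarrow> 'a set set \<Rightarrow> 'a \<Rightarrow> 'a set" where
  "nonneighborhood V E v = V - neighborhood E v"

text \<open>The colour \<open>i < r\<close> is available on \<open>A i\<close> only, and a fair coin decides between \<open>i\<close> and the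
  common colour \<open>r\<close>. This makes the first \<open>r\<close> entries of a signature independent, and the last one
  is determined by these together with the degree; so only pairs of equal degree can collide.\<close>

lemma multiset_chromatic_number_le_of_regularity:
  fixes V :: "'a set" and \<Delta> D m :: real
  assumes fin: "finite V" and E: "E \<subseteq> all_pairs V"
    and A: "disjoint_family_on A {..<r}" "\<And>i. i < r \<Longrightarrow> A i \<subseteq> V"
    and \<Delta>: "\<And>u. u \<in> V \<Longrightarrow> real (card (nonneighborhood V E u)) \<le> \<Delta>"
    and m: "m > 0" "\<And>u v i. {u, v} \<in> E \<Longrightarrow> i < r \<Longrightarrow>
      m \<le> real (card (nonneighborhood V E u \<inter> A i - nonneighborhood V E v))"
    and D: "\<And>k. real (card {v\<in>V. card (nonneighborhood V E v) = k}) \<le> D"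
    and pos: "\<Delta> \<ge> 1" "D \<ge> 1"
    and small: "16 * \<Delta>\<^sup>2 * D * (6 / sqrt (m * (1/2))) ^ r \<le> 1"
  shows "multiset_chromatic_number V E \<le> r + 1"
proof -
  let ?M = "nonneighborhood V E"
  define I where "I = {(u, v). {u, v} \<in> E \<and> card (?M u) = card (?M v)}"
  define F where "F = (\<lambda>(u, v). ?M u \<union> ?M v)"
  define cnt where "cnt = (\<lambda>i u y. card {w \<in> ?M u \<inter> A i. y w})"
  define Bad where "Bad = (\<lambda>(u, v) y. \<forall>i<r. cnt i u y = cnt i v y)"
  have IV: "I \<subseteq> V \<times> V"
    using E by (auto simp: I_def all_pairs_def)
  have finI: "finite I" by (rule finite_subset[OF IV]) (use fin in auto)
  have finM: "finite (?M u)" for u using fin by (simp add: nonneighborhood_def)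
  have MV: "?M u \<subseteq> V" for u by (auto simp: nonneighborhood_def)
  have sym: "w \<in> ?M u \<longleftrightarrow> u \<in> ?M w" if "u \<in> V" "w \<in> V" for u w
    using that by (auto simp: nonneighborhood_def neighborhood_def insert_commute)
  have "\<exists>y. \<forall>i\<in>I. \<not> Bad i y"
  proof (rule lovasz_local_lemma[where A = V and F = F and d = False and p = "\<lambda>_. bernoulli_pmf (1/2)"
        and c = "(6 / sqrt (m * (1/2))) ^ r" and k = "4 * \<Delta>\<^sup>2 * D"])
    fix e assume "e \<in> I"
    then obtain u v where e: "e = (u, v)" "{u, v} \<in> E" "u \<in> V" "v \<in> V"
      using IV by (auto simp: I_def)
    show "F e \<subseteq> V" using MV by (auto simp: F_def e)
    \<comment> \<open>\<open>B i\<close> holds the coins of block \<open>i\<close> seen by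
      \<open>u\<close> alone. Given all other coins, a collision prescribes the number of heads on
      each \<open>B i\<close>: the count of \<open>v\<close> minus that of the shared coins in
      \<open>C i\<close>.\<close>
    define B where "B = (\<lambda>i. ?M u \<inter> A i - ?M v)"
    define C where "C = (\<lambda>i. ?M u \<inter> A i \<inter> ?M v)"
    define g where "g = (\<lambda>i y. int (cnt i v y) - int (card {w \<in> C i. y w}))"
    have "{y. Bad e y} = {y. \<forall>i\<in>{..<r}. int (card {w \<in> B i. y w}) = g i y}"
    proof -
      have "cnt i u y = card {w \<in> B i. y w} + card {w \<in> C i. y w}" for i y
        unfolding cnt_def
        by (subst card_Un_disjoint[symmetric])
          (auto simp: B_def C_def finM intro!: arg_cong[where f = card])
      then have "(cnt i u y = cnt i v y) = (int (card {w \<in> B i. y w}) = g i y)" for i y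
        by (auto simp: g_def)
      then show ?thesis by (simp add: Bad_def e Ball_def)
    qed
    also have "measure_pmf.prob (Pi_pmf V False (\<lambda>_. bernoulli_pmf (1/2))) \<dots> \<le> (6 / sqrt (m * (1/2))) ^ card {..<r}"
    proof (rule prob_block_counts_le[OF fin])
      show "disjoint_family_on B {..<r}"
        using A(1) by (fastforce simp: disjoint_family_on_def B_def)
      show "B i \<subseteq> V" for i using MV by (auto simp: B_def)
      show "m \<le> real (card (B i))" if "i \<in> {..<r}" for i
        using m(2) e that by (auto simp: B_def)
      show "g i y = g i y'" if "i \<in> {..<r}" "\<And>x. x \<notin> (\<Union>w\<in>{..<r}. B w) \<Longrightarrow> y x = y' x" for i y y'
      proof -
        have "y x = y' x" if "x \<in> ?M v" for x
          using that \<open>\<And>x. x \<notin> (\<Union>w\<in>{..<r}. B w) \<Longrightarrow> y x = y' x\<close>[of x] by (auto simp: B_def)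
        then have "{w \<in> ?M v \<inter> A i. y w} = {w \<in> ?M v \<inter> A i. y' w}" "{w \<in> C i. y w} = {w \<in> C i. y' w}"
          by (auto simp: C_def)
        then show ?thesis by (simp add: g_def cnt_def)
      qed
    qed (use m in auto)
    finally show "measure_pmf.prob (Pi_pmf V False (\<lambda>_. bernoulli_pmf (1/2))) {y. Bad e y}
      \<le> (6 / sqrt (m * (1/2))) ^ r" by simp
    \<comment> \<open>Vertices within two steps of \<open>u\<close> or \<open>v\<close> in the
      complement: at most 2\<Delta> vertices in \<open>F e\<close>, each contributing at most
      \<Delta>.\<close>
    define W where "W = (\<Union>w\<in>F e. ?M w)"
    define cls where "cls = (\<lambda>u. {v\<in>V. card (?M v) = card (?M u)})"
    have FV: "F e \<subseteq> V" "finite (F e)" using MV finM by (auto simp: F_def e)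
    have WV: "finite W" "W \<subseteq> V" using MV FV by (auto simp: W_def finM)
    have cF: "real (card (F e)) \<le> 2 * \<Delta>"
      using card_Un_le[of "?M u" "?M v"] \<Delta>[OF e(3)] \<Delta>[OF e(4)] by (simp add: F_def e)
    have cW: "real (card W) \<le> 2 * \<Delta> * \<Delta>"
    proof -
      have "real (card W) \<le> real (\<Sum>w\<in>F e. card (?M w))"
        unfolding W_def of_nat_le_iff by (rule card_UN_le) (rule FV)
      also have "\<dots> = (\<Sum>w\<in>F e. real (card (?M w)))" by simp
      also have "\<dots> \<le> (\<Sum>w\<in>F e. \<Delta>)" using FV by (intro sum_mono \<Delta>) auto
      also have "\<dots> \<le> 2 * \<Delta> * \<Delta>" using cF pos by simp
      finally show ?thesis .
    qed
    \<comment> \<open>A pair that shares a coin with \<open>e\<close> has an endpoint in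
      \<open>W\<close>, by symmetry of non-adjacency, and its other endpoint is in the same degree
      class. Either endpoint can play this role, hence the swapped copy and the 4 in 4\<Delta>^2
      D.\<close>
    have sub: "{j \<in> I. F e \<inter> F j \<noteq> {}} \<subseteq> (SIGMA x:W. cls x) \<union> prod.swap ` (SIGMA x:W. cls x)"
    proof
      fix j assume "j \<in> {j \<in> I. F e \<inter> F j \<noteq> {}}"
      then obtain x y w where j: "j = (x, y)" "(x, y) \<in> I" "w \<in> F e" "w \<in> ?M x \<or> w \<in> ?M y"
        by (cases j) (auto simp: F_def)
      have V: "x \<in> V" "y \<in> V" "w \<in> V" using j IV FV by auto
      have "x \<in> W \<or> y \<in> W"
        using j V sym by (auto simp: W_def)
      moreover have "y \<in> cls x" "x \<in> cls y" using j V by (auto simp: cls_def I_def)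
      ultimately show "j \<in> (SIGMA x:W. cls x) \<union> prod.swap ` (SIGMA x:W. cls x)"
        by (force simp: j(1))
    qed
    have fc: "finite (cls x)" for x using fin by (auto simp: cls_def)
    have cS: "real (card (SIGMA x:W. cls x)) \<le> 2 * \<Delta> * \<Delta> * D"
    proof -
      have "real (card (SIGMA x:W. cls x)) = (\<Sum>x\<in>W. real (card (cls x)))"
        using WV fc by (subst card_SigmaI) auto
      also have "\<dots> \<le> (\<Sum>x\<in>W. D)" unfolding cls_def by (intro sum_mono D)
      also have "\<dots> \<le> 2 * \<Delta> * \<Delta> * D" using mult_right_mono[OF cW, of D] pos by simp
      finally show ?thesis .
    qed
    have "card {j \<in> I. F e \<inter> F j \<noteq> {}} \<le> card ((SIGMA x:W. cls x) \<union> prod.swap ` (SIGMA x:W. cls x))"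
      using WV fc by (intro card_mono sub) auto
    also have "\<dots> \<le> card (SIGMA x:W. cls x) + card (prod.swap ` (SIGMA x:W. cls x))"
      by (rule card_Un_le)
    also have "card (prod.swap ` (SIGMA x:W. cls x)) = card (SIGMA x:W. cls x)"
      by (intro card_image) auto
    finally have "real (card {j \<in> I. F e \<inter> F j \<noteq> {}}) \<le> 2 * real (card (SIGMA x:W. cls x))" by linarith
    also have "\<dots> \<le> 4 * \<Delta>\<^sup>2 * D" using cS by (simp add: power2_eq_square mult_ac)
    finally show "real (card {j \<in> I. F e \<inter> F j \<noteq> {}}) \<le> 4 * \<Delta>\<^sup>2 * D" .
  next
    fix e and y y' :: "'a \<Rightarrow> bool" assume e: "e \<in> I" and y: "\<And>x. x \<in> F e \<Longrightarrow> y x = y' x"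
    obtain u v where uv: "e = (u, v)" by (cases e)
    have "{w \<in> ?M u \<inter> A i. y w} = {w \<in> ?M u \<inter> A i. y' w}" "{w \<in> ?M v \<inter> A i. y w} = {w \<in> ?M v \<inter> A i. y' w}" for i
      using y by (auto simp: uv F_def)
    then show "Bad e y = Bad e y'" by (simp add: Bad_def uv cnt_def)
  next
    have "1 * 1 \<le> \<Delta>\<^sup>2 * D" using pos by (intro mult_mono) (auto simp: one_le_power)
    then show "1 \<le> 4 * \<Delta>\<^sup>2 * D" by simp
    show "4 * (6 / sqrt (m * (1 / 2))) ^ r * (4 * \<Delta>\<^sup>2 * D) \<le> 1"
      using small by (simp add: mult_ac)
  qed (use fin finI m in auto)
  then obtain y where ally: "\<forall>e\<in>I. \<not> Bad e y" by blast
  have y: "\<exists>i<r. cnt i u y \<noteq> cnt i v y" if "(u, v) \<in> I" for u v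
    using bspec[OF ally that] by (auto simp: Bad_def)
  \<comment> \<open>The blocks need not cover \<open>V\<close>: a vertex outside all of them
    receives the common colour \<open>r\<close>, just as one whose coin fails.\<close>
  define col where "col = (\<lambda>w. if \<exists>i<r. w \<in> A i \<and> y w then (THE i. i < r \<and> w \<in> A i) else r)"
  have the: "(THE j. j < r \<and> w \<in> A j) = i" if "i < r" "w \<in> A i" for i w
    using that A(1) by (intro the_equality) (auto simp: disjoint_family_on_def)
  have col_i: "col w = i \<longleftrightarrow> w \<in> A i \<and> y w" if "i < r" for i w
    using that the by (auto simp: col_def)
  have col_le: "col w < r + 1" for w
    using the by (auto simp: col_def)
  show ?thesis
  proof (rule multiset_chromatic_number_le[OF fin E, of col])
    fix u v assume uv: "{u, v} \<in> E"
    have N: "neighborhood E x \<subseteq> V" for x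
      using E by (auto simp: neighborhood_def all_pairs_def)
    have finN: "finite (neighborhood E x)" for x using N fin finite_subset by blast
    show "\<exists>i<r + 1. card {w \<in> neighborhood E u. col w = i} \<noteq> card {w \<in> neighborhood E v. col w = i}"
    proof (rule ccontr)
      assume "\<not> ?thesis"
      then have eq: "card {w \<in> neighborhood E u. col w = i} = card {w \<in> neighborhood E v. col w = i}"
        if "i < r + 1" for i using that by blast
      have tot: "card (neighborhood E x) = (\<Sum>i<r + 1. card {w \<in> neighborhood E x. col w = i})" for x
      proof -
        have "card (neighborhood E x) = (\<Sum>w\<in>neighborhood E x. 1)" by simp
        also have "\<dots> = (\<Sum>i\<in>{..<r+1}. \<Sum>w\<in>{w \<in> neighborhood E x. col w = i}. 1)"
          by (rule sum.group[symmetric]) (use finN col_le in auto)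
        finally show ?thesis by simp
      qed
      have "card (neighborhood E u) = card (neighborhood E v)"
        unfolding tot by (intro sum.cong eq) auto
      then have "card (?M u) = card (?M v)"
        using N finN by (simp add: nonneighborhood_def card_Diff_subset)
      then have "(u, v) \<in> I" using uv by (simp add: I_def)
      then obtain i where i: "i < r" "cnt i u y \<noteq> cnt i v y" using y by blast
      \<comment> \<open>Neighbours and non-neighbours of \<open>x\<close> together exhaust colour
        class \<open>i\<close>, so equal signature entries would force equal values of
        \<open>cnt\<close>.\<close>
      have cnt: "cnt i x y + card {w \<in> neighborhood E x. col w = i} = card {w \<in> A i. y w}" for x
      proof -
        have "{w \<in> neighborhood E x. col w = i} = {w \<in> neighborhood E x \<inter> A i. y w}"
          using col_i[OF i(1)] by auto
        moreover have "cnt i x y + card {w \<in> neighborhood E x \<inter> A i. y w} = card {w \<in> A i. y w}"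
          unfolding cnt_def using A(2)[OF i(1)]
          by (subst card_Un_disjoint[symmetric])
            (auto simp: nonneighborhood_def fin finN intro!: arg_cong[where f = card])
        ultimately show ?thesis by simp
      qed
      show False using cnt[of u] cnt[of v] eq[of i] i by simp
    qed
  qed (rule col_le)
qed

text \<open>Pigeonhole. Discarding the vertices that deviate on some part costs at most half of
  \<open>V\<close>, which is why \<open>conc\<close> carries the factor \<open>length Ps\<close>.
  The remaining signatures lie in a box with at most (2t+1)^q points, and the vertices sharing a
  signature are pairwise non-adjacent.\<close>

lemma card_le_of_multiset_coloring:
  fixes V :: "'a set" and p t :: real and K :: nat
  assumes fin: "finite V" and E: "E \<subseteq> all_pairs V"
    and col: "multiset_coloring V E Ps"
    and indep: "\<And>S. S \<subseteq> V \<Longrightarrow> (\<And>u v. u \<in> S \<Longrightarrow> v \<in> S \<Longrightarrow> {u, v} \<notin> E) \<Longrightarrow> card S \<le> K"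
    and t: "t \<ge> 0"
    and conc: "\<And>T. T \<subseteq> V \<Longrightarrow> real (length Ps) *
      real (card {v\<in>V. \<bar>real (card (neighborhood E v \<inter> T)) - p * real (card T)\<bar> > t}) \<le> real (card V) / 2"
  shows "real (card V) \<le> 2 * real K * (2 * t + 1) ^ length Ps"
proof (cases "Ps = []")
  case True
  then have "V = {}"
    using col by (auto simp: multiset_coloring_def ordered_partition_def partition_on_def)
  then show ?thesis using t by simp
next
  case False
  define q where "q = length Ps"
  have q: "q > 0" using False by (simp add: q_def)
  define b where "b = (\<lambda>i. {v\<in>V. \<bar>real (card (neighborhood E v \<inter> Ps ! i)) - p * real (card (Ps ! i))\<bar> > t})"
  define G where "G = V - (\<Union>i<q. b i)"
  have PsV: "Ps ! i \<subseteq> V" if "i < q" for i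
    using col that nth_mem[of i Ps]
    by (force simp: multiset_coloring_def ordered_partition_def partition_on_def q_def)
  have bfin: "finite (b i)" for i using fin by (simp add: b_def)
  have bi: "real (card (b i)) \<le> real (card V) / 2 / real q" if "i < q" for i
    using conc[OF PsV[OF that]] q unfolding b_def q_def[symmetric] by (simp add: field_simps)
  have "real (card (\<Union>i<q. b i)) \<le> real (\<Sum>i<q. card (b i))"
    unfolding of_nat_le_iff by (rule card_UN_le) auto
  also have "\<dots> = (\<Sum>i<q. real (card (b i)))" by simp
  also have "\<dots> \<le> (\<Sum>i<q. real (card V) / 2 / real q)"
    by (intro sum_mono bi) auto
  also have "\<dots> = real (card V) / 2" using q by simp
  finally have "real (card (\<Union>i<q. b i)) \<le> real (card V) / 2" .
  moreover have "card G = card V - card (\<Union>i<q. b i)"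
    unfolding G_def using bfin by (intro card_Diff_subset) (auto simp: b_def)
  ultimately have G: "real (card V) \<le> 2 * real (card G)" by linarith
  define N where "N = (\<lambda>i. {k::nat. \<bar>real k - p * real (card (Ps ! i))\<bar> \<le> t})"
  have N: "finite (N i)" "real (card (N i)) \<le> 2 * t + 1" for i
  proof -
    define a where "a = p * real (card (Ps ! i))"
    have sub: "N i \<subseteq> nat ` {\<lceil>a - t\<rceil>..\<lfloor>a + t\<rfloor>}"
    proof
      fix k assume "k \<in> N i"
      then have "int k \<in> {\<lceil>a - t\<rceil>..\<lfloor>a + t\<rfloor>}"
        by (auto simp: N_def a_def ceiling_le_iff le_floor_iff abs_if split: if_splits)
      then show "k \<in> nat ` {\<lceil>a - t\<rceil>..\<lfloor>a + t\<rfloor>}" by (metis imageI nat_int)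
    qed
    then show "finite (N i)" using finite_surj by blast
    have "card (N i) \<le> card {\<lceil>a - t\<rceil>..\<lfloor>a + t\<rfloor>}"
      using card_mono[OF _ sub] card_image_le[of "{\<lceil>a - t\<rceil>..\<lfloor>a + t\<rfloor>}" nat] by auto
    \<comment> \<open>A closed interval of length 2t contains at most 2t + 1 integers, wherever its
      centre lies.\<close>
    also have "real (card {\<lceil>a - t\<rceil>..\<lfloor>a + t\<rfloor>}) \<le> 2 * t + 1"
      using t by simp linarith
    finally show "real (card (N i)) \<le> 2 * t + 1" by simp
  qed
  define s where "s = (\<lambda>v. \<lambda>i\<in>{..<q}. card (neighborhood E v \<inter> Ps ! i))"
  have simg: "s ` G \<subseteq> Pi\<^sub>E {..<q} N"
    by (auto simp: s_def G_def b_def N_def)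
  have finP: "finite (Pi\<^sub>E {..<q} N)" using N by (intro finite_PiE) auto
  have fib: "card {v\<in>G. s v = x} \<le> K" for x
  proof (rule indep)
    show "{v\<in>G. s v = x} \<subseteq> V" by (auto simp: G_def)
    fix u v assume uv: "u \<in> {v\<in>G. s v = x}" "v \<in> {v\<in>G. s v = x}"
    then have "s u = s v" by simp
    then have "card (neighborhood E u \<inter> Ps ! i) = card (neighborhood E v \<inter> Ps ! i)" if "i < q" for i
      using that by (auto simp: s_def restrict_def fun_eq_iff) (metis)
    then have "signature E Ps u = signature E Ps v"
      by (auto simp: signature_def q_def list_eq_iff_nth_eq)
    then show "{u, v} \<notin> E" using col by (auto simp: multiset_coloring_def)
  qed
  have "card G = (\<Sum>x\<in>Pi\<^sub>E {..<q} N. card {v\<in>G. s v = x})"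
  proof -
    have "card G = (\<Sum>v\<in>G. 1)" by simp
    also have "\<dots> = (\<Sum>x\<in>Pi\<^sub>E {..<q} N. \<Sum>v\<in>{v\<in>G. s v = x}. 1)"
      by (rule sum.group[symmetric]) (use fin simg finP in \<open>auto simp: G_def\<close>)
    finally show ?thesis by simp
  qed
  also have "\<dots> \<le> (\<Sum>x\<in>Pi\<^sub>E {..<q} N. K)" by (intro sum_mono fib)
  also have "\<dots> = (\<Prod>i<q. card (N i)) * K" by (simp add: card_PiE)
  finally have "real (card G) \<le> real ((\<Prod>i<q. card (N i)) * K)" by (rule of_nat_mono)
  also have "\<dots> = (\<Prod>i<q. real (card (N i))) * real K" by simp
  also have "\<dots> \<le> (\<Prod>i<q. 2 * t + 1) * real K"
    by (intro mult_right_mono prod_mono conjI N) auto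
  finally show ?thesis using G by (simp add: q_def mult_ac)
qed

section \<open>Tail bounds for random graphs\<close>

lemma exp_le_quadratic:
  fixes x :: real
  assumes "\<bar>x\<bar> \<le> 1"
  shows "exp x \<le> 1 + x + x\<^sup>2"
proof (cases "x \<ge> 0")
  case True
  then show ?thesis using exp_bound[of x] assms by auto
next
  case False
  define a where "a = - x"
  have a: "a \<ge> 0" using False by (simp add: a_def)
  \<comment> \<open>To bound exp(-a) it suffices that (1 - a + a^2) exp a is at least 1, and the
    quadratic Taylor polynomial of exp a already achieves this.\<close>
  have "1 \<le> (1 - a + a\<^sup>2) * (1 + a + a\<^sup>2 / 2)"
  proof -
    have "(1 - a + a\<^sup>2) * (1 + a + a\<^sup>2 / 2) = 1 + a^2 / 2 + a^3 / 2 + a^4 / 2"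
      by (simp add: field_simps power2_eq_square power3_eq_cube power4_eq_xxxx)
    then show ?thesis using a by simp
  qed
  also have "\<dots> \<le> (1 - a + a\<^sup>2) * exp a"
  proof (intro mult_left_mono exp_lower_Taylor_quadratic a)
    have "0 \<le> (a - 1/2)\<^sup>2 + 3/4" by simp
    then show "0 \<le> 1 - a + a\<^sup>2" by (simp add: power2_eq_square algebra_simps)
  qed
  finally have "exp (- a) \<le> 1 - a + a\<^sup>2"
    by (simp add: exp_minus field_simps)
  then show ?thesis by (simp add: a_def)
qed

text \<open>The variance proxy is \<open>q\<close>, not a constant: for sparse graphs
  \<open>q\<close> tends to 0, and deviations must be measured against the square root of the mean
  rather than of the number of pairs.\<close>

lemma bernoulli_mgf_le:
  fixes q \<theta> :: real
  assumes q: "0 \<le> q" "q \<le> 1" and \<theta>: "\<bar>\<theta>\<bar> \<le> 1"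
  shows "measure_pmf.expectation (bernoulli_pmf q) (\<lambda>b. exp (\<theta> * (of_bool b - q))) \<le> exp (q * \<theta>\<^sup>2)"
proof -
  have "measure_pmf.expectation (bernoulli_pmf q) (\<lambda>b. exp (\<theta> * (of_bool b - q)))
      = exp (- (\<theta> * q)) * (1 + q * (exp \<theta> - 1))"
    using q by (simp add: algebra_simps flip: exp_add)
  also have "\<dots> \<le> exp (- (\<theta> * q)) * exp (q * (\<theta> + \<theta>\<^sup>2))"
  proof (intro mult_left_mono)
    have "1 + q * (exp \<theta> - 1) \<le> 1 + q * (\<theta> + \<theta>\<^sup>2)"
      using mult_left_mono[OF exp_le_quadratic[OF \<theta>] q(1)] by (simp add: algebra_simps)
    also have "\<dots> \<le> exp (q * (\<theta> + \<theta>\<^sup>2))" by (rule exp_ge_add_one_self)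
    finally show "1 + q * (exp \<theta> - 1) \<le> exp (q * (\<theta> + \<theta>\<^sup>2))" .
  qed auto
  also have "\<dots> = exp (q * \<theta>\<^sup>2)"
    by (simp add: algebra_simps flip: exp_add)
  finally show ?thesis .
qed

text \<open>Markov's inequality for the exponential moment. General weights cover three uses:
  indicators of a set of pairs, negative signs for lower tails, and pairs that are counted
  twice.\<close>

lemma chernoff_weighted:
  fixes w :: "'a \<Rightarrow> real" and q \<theta> a :: real
  assumes fin: "finite A" and q: "0 \<le> q" "q \<le> 1" and \<theta>: "\<theta> > 0"
    and w: "\<And>e. e \<in> A \<Longrightarrow> \<bar>\<theta> * w e\<bar> \<le> 1"
  shows "measure_pmf.prob (Pi_pmf A d (\<lambda>_. bernoulli_pmf q))
      {y. (\<Sum>e\<in>A. w e * (of_bool (y e) - q)) \<ge> a} \<le> exp (\<theta>\<^sup>2 * q * (\<Sum>e\<in>A. (w e)\<^sup>2) - \<theta> * a)"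
proof -
  let ?N = "Pi_pmf A d (\<lambda>_. bernoulli_pmf q)"
  define X where "X = (\<lambda>y. \<Prod>e\<in>A. exp (\<theta> * w e * (of_bool (y e) - q)))"
  have X: "X y = exp (\<theta> * (\<Sum>e\<in>A. w e * (of_bool (y e) - q)))" for y
    unfolding X_def by (simp add: exp_sum[OF fin] sum_distrib_left mult.assoc)
  have int: "integrable (measure_pmf (bernoulli_pmf q)) f" for f :: "bool \<Rightarrow> real"
    by (intro integrable_measure_pmf_finite) (auto intro: finite_subset[of _ UNIV])
  have intX: "integrable ?N X"
    unfolding X_def by (intro integrable_prod_Pi_pmf fin int)
  have "measure_pmf.prob ?N {y. (\<Sum>e\<in>A. w e * (of_bool (y e) - q)) \<ge> a} =
        measure_pmf.prob ?N {y \<in> space ?N. X y \<ge> exp (\<theta> * a)}"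
    using \<theta> by (intro arg_cong[where f = "measure _"]) (auto simp: X)
  also have "\<dots> \<le> measure_pmf.expectation ?N X / exp (\<theta> * a)"
    by (rule integral_Markov_inequality_measure[OF intX, of "{}"]) (auto simp: X)
  also have "measure_pmf.expectation ?N X =
      (\<Prod>e\<in>A. measure_pmf.expectation (bernoulli_pmf q) (\<lambda>b. exp (\<theta> * w e * (of_bool b - q))))"
    unfolding X_def by (intro expectation_prod_Pi_pmf fin int) auto
  also have "\<dots> \<le> (\<Prod>e\<in>A. exp (q * (\<theta> * w e)\<^sup>2))"
    by (intro prod_mono conjI bernoulli_mgf_le q w integral_nonneg_AE) auto
  also have "\<dots> = exp (\<theta>\<^sup>2 * q * (\<Sum>e\<in>A. (w e)\<^sup>2))"
    by (simp add: exp_sum[OF fin, symmetric] sum_distrib_left power_mult_distrib mult_ac)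
  finally show ?thesis
    by (simp add: exp_diff divide_right_mono)
qed

lemma sum_of_bool_mem:
  fixes f :: "'a \<Rightarrow> real"
  assumes "finite A" "B \<subseteq> A"
  shows "(\<Sum>e\<in>A. of_bool (e \<in> B) * f e) = (\<Sum>e\<in>B. f e)"
proof -
  have "A \<inter> {e. e \<in> B} = B" using assms(2) by auto
  then show ?thesis using assms(1) by (simp add: of_bool_def if_distrib[of "\<lambda>x. x * _"] sum.If_cases cong: if_cong)
qed

lemma sum_of_bool_square:
  assumes "finite A" "B \<subseteq> A"
  shows "(\<Sum>e\<in>A. (of_bool (e \<in> B))\<^sup>2) = real (card B)"
proof -
  have "(\<Sum>e\<in>A. (of_bool (e \<in> B))\<^sup>2) = (\<Sum>e\<in>A. of_bool (e \<in> B) * (1::real))"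
    by (intro sum.cong) auto
  then show ?thesis using sum_of_bool_mem[OF assms, of "\<lambda>_. 1"] by simp
qed

lemma sum_centred:
  fixes q :: real
  assumes "finite B"
  shows "(\<Sum>e\<in>B. of_bool (y e) - q) = real (card {e\<in>B. y e}) - q * real (card B)"
  using assms by (simp add: sum_subtractf sum_of_bool_eq Int_def mult.commute)

lemma prob_count_upper:
  assumes fin: "finite A" "B \<subseteq> A" and q: "0 \<le> q" "q \<le> 1" and \<mu>: "q * real (card B) \<le> \<mu>"
  shows "measure_pmf.prob (Pi_pmf A d (\<lambda>_. bernoulli_pmf q)) {y. real (card {e\<in>B. y e}) \<ge> 2 * \<mu>} \<le> exp (- \<mu> / 4)"
proof -
  let ?s = "q * real (card B)"
  have fB: "finite B" using fin finite_subset by blast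
  have "{y. real (card {e\<in>B. y e}) \<ge> 2 * \<mu>} =
    {y. (\<Sum>e\<in>A. of_bool (e \<in> B) * (of_bool (y e) - q)) \<ge> 2 * \<mu> - ?s}"
    by (simp add: sum_of_bool_mem[OF fin] sum_centred[OF fB])
  \<comment> \<open>With \<theta> = 1/2 the exponent is 3s/4 - \<mu>, where s is the mean, and s is
    at most \<mu>.\<close>
  also have "measure_pmf.prob (Pi_pmf A d (\<lambda>_. bernoulli_pmf q)) \<dots> \<le>
     exp ((1/2)\<^sup>2 * q * (\<Sum>e\<in>A. (of_bool (e \<in> B))\<^sup>2) - 1/2 * (2 * \<mu> - ?s))"
    by (rule chernoff_weighted[OF fin(1) q]) auto
  also have "(\<Sum>e\<in>A. (of_bool (e \<in> B))\<^sup>2) = real (card B)"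
    using sum_of_bool_square[OF fin] by simp
  also have "exp ((1/2)\<^sup>2 * q * real (card B) - 1/2 * (2 * \<mu> - ?s)) \<le> exp (- \<mu> / 4)"
    using \<mu> by (simp add: power2_eq_square field_simps)
  finally show ?thesis .
qed

lemma prob_count_lower:
  assumes fin: "finite A" "B \<subseteq> A" and q: "0 \<le> q" "q \<le> 1"
  shows "measure_pmf.prob (Pi_pmf A d (\<lambda>_. bernoulli_pmf q)) {y. real (card {e\<in>B. y e}) \<le> q * real (card B) / 2}
    \<le> exp (- (q * real (card B)) / 16)"
proof -
  let ?s = "q * real (card B)"
  have fB: "finite B" using fin finite_subset by blast
  have neg: "(\<Sum>e\<in>A. - of_bool (e \<in> B) * (of_bool (y e) - q)) = ?s - real (card {e\<in>B. y e})" for y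
    by (simp add: sum_negf sum_of_bool_mem[OF fin] sum_centred[OF fB])
  have "{y. real (card {e\<in>B. y e}) \<le> q * real (card B) / 2} =
    {y. (\<Sum>e\<in>A. - of_bool (e \<in> B) * (of_bool (y e) - q)) \<ge> ?s / 2}"
    unfolding neg by auto
  \<comment> \<open>With \<theta> = 1/4 and weights -1 the exponent is s/16 - s/8 = -s/16.\<close>
  also have "measure_pmf.prob (Pi_pmf A d (\<lambda>_. bernoulli_pmf q)) \<dots> \<le>
     exp ((1/4)\<^sup>2 * q * (\<Sum>e\<in>A. (- of_bool (e \<in> B))\<^sup>2) - 1/4 * (?s / 2))"
    by (rule chernoff_weighted[OF fin(1) q]) auto
  also have "(\<Sum>e\<in>A. (- of_bool (e \<in> B))\<^sup>2) = real (card B)"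
    using sum_of_bool_square[OF fin] by simp
  also have "exp ((1/4)\<^sup>2 * q * real (card B) - 1/4 * (?s / 2)) = exp (- (q * real (card B)) / 16)"
    by (simp add: power2_eq_square)
  finally show ?thesis .
qed

lemma prob_all_true:
  assumes "finite A" "B \<subseteq> A" "0 \<le> q" "q \<le> 1"
  shows "measure_pmf.prob (Pi_pmf A d (\<lambda>_. bernoulli_pmf q)) {y. \<forall>e\<in>B. y e} = q ^ card B"
proof -
  have fB: "finite B" using assms finite_subset by blast
  have "measure_pmf.prob (Pi_pmf A d (\<lambda>_. bernoulli_pmf q)) {y. \<forall>e\<in>B. y e} =
        measure_pmf.prob (Pi_pmf B d (\<lambda>_. bernoulli_pmf q)) {y. \<forall>e\<in>B. y e}"
    by (rule prob_Pi_pmf_restrict_coords) (use assms in auto)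
  also have "\<dots> = measure_pmf.prob (Pi_pmf B d (\<lambda>_. bernoulli_pmf q)) (Pi B (\<lambda>_. {True}))"
    by (intro arg_cong[where f = "measure _"]) auto
  also have "\<dots> = q ^ card B"
    using assms by (subst measure_Pi_pmf_Pi[OF fB]) (simp add: measure_pmf_single)
  finally show ?thesis .
qed

section \<open>Random graphs described by their missing pairs\<close>

text \<open>We sample the non-edges of the graph: \<open>y e\<close> says that the pair \<open>e\<close> is missing.\<close>

definition nonedge_pmf :: "'a set \<Rightarrow> real \<Rightarrow> ('a set \<Rightarrow> bool) pmf" where
  "nonedge_pmf V q = Pi_pmf (all_pairs V) False (\<lambda>_. bernoulli_pmf q)"

definition complement_graph :: "'a set \<Rightarrow> ('a set \<Rightarrow> bool) \<Rightarrow> 'a set set" where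
  "complement_graph V y = {e \<in> all_pairs V. \<not> y e}"

lemma finite_all_pairs [simp]: "finite V \<Longrightarrow> finite (all_pairs V)"
  unfolding all_pairs_def by simp

lemma all_pairs_mono: "S \<subseteq> V \<Longrightarrow> all_pairs S \<subseteq> all_pairs V"
  by (auto simp: all_pairs_def)

lemma pair_mem_all_pairs: "{u, v} \<in> all_pairs V \<longleftrightarrow> u \<in> V \<and> v \<in> V \<and> u \<noteq> v"
  by (auto simp: all_pairs_def card_insert_if)

lemma gnp_eq_complement:
  assumes "0 \<le> p" "p \<le> 1"
  shows "gnp n p = map_pmf (complement_graph {1..n}) (nonedge_pmf {1..n} (1 - p))"
proof -
  let ?A = "all_pairs {1..n}"
  have "bernoulli_pmf p = map_pmf Not (bernoulli_pmf (1 - p))"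
  proof (rule pmf_eqI)
    fix b
    have "pmf (map_pmf Not (bernoulli_pmf (1 - p))) (\<not> \<not> b) = pmf (bernoulli_pmf (1 - p)) (\<not> b)"
      by (rule pmf_map_inj') (auto simp: inj_def)
    then show "pmf (bernoulli_pmf p) b = pmf (map_pmf Not (bernoulli_pmf (1 - p))) b"
      using assms by (cases b) auto
  qed
  then have "Pi_pmf ?A False (\<lambda>_. bernoulli_pmf p) =
     Pi_pmf ?A False (\<lambda>_. map_pmf Not (bernoulli_pmf (1 - p)))" by simp
  also have "\<dots> = map_pmf (\<lambda>h. Not \<circ> h) (Pi_pmf ?A True (\<lambda>_. bernoulli_pmf (1 - p)))"
    by (rule Pi_pmf_map) auto
  \<comment> \<open>Negation turns the default \<open>True\<close> into the default
    \<open>False\<close> of \<open>gnp\<close>. The swap to the default \<open>False\<close> of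
    \<open>nonedge_pmf\<close> is invisible because the graph reads only coordinates in
    \<open>all_pairs\<close>.\<close>
  also have "Pi_pmf ?A True (\<lambda>_. bernoulli_pmf (1 - p)) =
    map_pmf (\<lambda>f x. if x \<in> ?A then f x else True) (nonedge_pmf {1..n} (1 - p))"
    unfolding nonedge_pmf_def by (rule Pi_pmf_default_swap[symmetric]) auto
  finally have "gnp n p = map_pmf (\<lambda>y. {e \<in> ?A. (Not \<circ> (\<lambda>x. if x \<in> ?A then y x else True)) e})
      (nonedge_pmf {1..n} (1 - p))"
    unfolding gnp_def by (simp add: pmf.map_comp comp_def)
  also have "\<dots> = map_pmf (complement_graph {1..n}) (nonedge_pmf {1..n} (1 - p))"
    by (intro map_pmf_cong) (auto simp: complement_graph_def)
  finally show ?thesis .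
qed

lemma prob_union_card_le:
  assumes "finite V" "c \<ge> 0"
    and "\<And>S. S \<subseteq> V \<Longrightarrow> card S = k \<Longrightarrow> measure_pmf.prob M {y. P S y} \<le> c"
  shows "measure_pmf.prob M {y. \<exists>S\<subseteq>V. card S = k \<and> P S y} \<le> real (card V choose k) * c"
proof -
  have fin: "finite {S. S \<subseteq> V \<and> card S = k}" using assms(1) by simp
  have "{y. \<exists>S\<subseteq>V. card S = k \<and> P S y} = (\<Union>S\<in>{S. S \<subseteq> V \<and> card S = k}. {y. P S y})" by auto
  then have "measure_pmf.prob M {y. \<exists>S\<subseteq>V. card S = k \<and> P S y}
      \<le> (\<Sum>S\<in>{S. S \<subseteq> V \<and> card S = k}. measure_pmf.prob M {y. P S y})"
    using measure_UNION_le[OF fin, of "\<lambda>S. {y. P S y}" "measure_pmf M"] by simp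
  also have "\<dots> \<le> (\<Sum>S\<in>{S. S \<subseteq> V \<and> card S = k}. c)"
    using assms(3) by (intro sum_mono) auto
  also have "\<dots> = real (card V choose k) * c" using n_subsets[OF assms(1)] by simp
  finally show ?thesis .
qed

lemma prob_ball_union_le:
  assumes "finite I" "\<And>i. i \<in> I \<Longrightarrow> measure_pmf.prob M {y. P i y} \<le> c"
  shows "measure_pmf.prob M {y. \<exists>i\<in>I. P i y} \<le> real (card I) * c"
proof -
  have "{y. \<exists>i\<in>I. P i y} = (\<Union>i\<in>I. {y. P i y})" by auto
  then have "measure_pmf.prob M {y. \<exists>i\<in>I. P i y} \<le> (\<Sum>i\<in>I. measure_pmf.prob M {y. P i y})"
    using measure_UNION_le[OF assms(1), of "\<lambda>i. {y. P i y}" "measure_pmf M"] by simp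
  also have "\<dots> \<le> (\<Sum>i\<in>I. c)" using assms(2) by (intro sum_mono) auto
  finally show ?thesis by simp
qed

lemma prob_clique_le:
  assumes "finite V" "0 \<le> q" "q \<le> 1"
  shows "measure_pmf.prob (nonedge_pmf V q) {y. \<exists>S\<subseteq>V. card S = k \<and> (\<forall>e\<in>all_pairs S. y e)}
    \<le> real (card V choose k) * q ^ (k choose 2)"
proof (rule prob_union_card_le[OF assms(1)])
  fix S assume S: "S \<subseteq> V" "card S = k"
  then have "finite S" using assms(1) finite_subset by blast
  then have "card (all_pairs S) = k choose 2"
    using n_subsets[of S 2] S by (simp add: all_pairs_def)
  then show "measure_pmf.prob (nonedge_pmf V q) {y. \<forall>e\<in>all_pairs S. y e} \<le> q ^ (k choose 2)"
    unfolding nonedge_pmf_def using assms S prob_all_true[OF _ all_pairs_mono[OF S(1)]] by simp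
qed (use assms in auto)

text \<open>The double sum runs over ordered pairs, whose indicators are not independent. Grouped by
  unordered pairs it becomes a weighted sum with weights at most 2, so the squared weights sum to at
  most 2|S||V|.\<close>

lemma prob_discrepancy_le:
  fixes q \<theta> a :: real
  assumes fin: "finite V" and q: "0 \<le> q" "q \<le> 1" and \<theta>: "0 < \<theta>" "\<theta> \<le> 1/2"
    and S: "S \<subseteq> V" and T: "T \<subseteq> V"
  shows "measure_pmf.prob (nonedge_pmf V q)
      {y. \<bar>\<Sum>v\<in>S. \<Sum>u\<in>T - {v}. of_bool (y {u, v}) - q\<bar> \<ge> a}
    \<le> 2 * exp (2 * \<theta>\<^sup>2 * q * real (card S) * real (card V) - \<theta> * a)"
proof -
  define A where "A = all_pairs V"
  have fA: "finite A" using fin by (simp add: A_def)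
  have fST: "finite S" "finite T" using S T fin finite_subset by auto
  define P where "P = (SIGMA v:S. T - {v})"
  define e where "e = (\<lambda>x :: 'a \<times> 'a. {snd x, fst x})"
  have fP: "finite P" using fST by (simp add: P_def)
  have eP: "e ` P \<subseteq> A" using S T by (auto simp: P_def e_def A_def pair_mem_all_pairs)
  \<comment> \<open>The weight is 2 exactly when both ends of the pair lie in both \<open>S\<close>
    and \<open>T\<close>; the bound 2 explains why \<theta> is limited to 1/2.\<close>
  define w where "w = (\<lambda>b. real (card {x\<in>P. e x = b}))"
  have w2: "w b \<le> 2" if bA: "b \<in> A" for b
  proof -
    obtain c d where b: "b = {c, d}"
      using bA unfolding A_def all_pairs_def card_2_iff by blast
    have "{x\<in>P. e x = b} \<subseteq> {(c, d), (d, c)}"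
      by (auto simp: e_def b P_def doubleton_eq_iff)
    then have "card {x\<in>P. e x = b} \<le> card {(c, d), (d, c)}" by (intro card_mono) auto
    also have "\<dots> \<le> 2" using card_length[of "[(c, d), (d, c)]"] by simp
    finally show ?thesis unfolding w_def by linarith
  qed
  have w0: "w b \<ge> 0" for b by (simp add: w_def)
  have grp: "(\<Sum>b\<in>A. w b * f b) = (\<Sum>v\<in>S. \<Sum>u\<in>T - {v}. f {u, v})" for f :: "'a set \<Rightarrow> real"
  proof -
    have "(\<Sum>v\<in>S. \<Sum>u\<in>T - {v}. f {u, v}) = (\<Sum>x\<in>P. f (e x))"
      unfolding P_def e_def using fST by (subst sum.Sigma) (auto intro!: sum.cong)
    also have "\<dots> = (\<Sum>b\<in>A. \<Sum>x\<in>{x\<in>P. e x = b}. f (e x))"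
      by (rule sum.group[symmetric, OF fP fA eP])
    also have "\<dots> = (\<Sum>b\<in>A. w b * f b)"
      by (intro sum.cong) (auto simp: w_def)
    finally show ?thesis by simp
  qed
  have "(\<Sum>b\<in>A. w b) = (\<Sum>v\<in>S. real (card (T - {v})))"
    using grp[of "\<lambda>_. 1"] by simp
  also have "\<dots> \<le> (\<Sum>v\<in>S. real (card V))"
    using T fin by (intro sum_mono) (auto intro!: card_mono)
  finally have sw: "(\<Sum>b\<in>A. w b) \<le> real (card S) * real (card V)" by simp
  have "(\<Sum>b\<in>A. (w b)\<^sup>2) \<le> (\<Sum>b\<in>A. 2 * w b)"
    unfolding power2_eq_square using w2 w0 by (intro sum_mono mult_right_mono) auto
  also have "\<dots> \<le> 2 * (real (card S) * real (card V))"
    using sw by (simp add: sum_distrib_left[symmetric])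
  finally have sw2: "(\<Sum>b\<in>A. (w b)\<^sup>2) \<le> 2 * (real (card S) * real (card V))" .
  have one: "measure_pmf.prob (nonedge_pmf V q) {y. (\<Sum>b\<in>A. (s * w b) * (of_bool (y b) - q)) \<ge> a}
      \<le> exp (2 * \<theta>\<^sup>2 * q * real (card S) * real (card V) - \<theta> * a)" if s: "\<bar>s\<bar> = 1" for s
  proof -
    have "measure_pmf.prob (nonedge_pmf V q) {y. (\<Sum>b\<in>A. (s * w b) * (of_bool (y b) - q)) \<ge> a} \<le>
      exp (\<theta>\<^sup>2 * q * (\<Sum>b\<in>A. (s * w b)\<^sup>2) - \<theta> * a)"
      unfolding nonedge_pmf_def A_def[symmetric]
    proof (rule chernoff_weighted[OF fA q \<theta>(1)])
      fix b assume "b \<in> A"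
      then show "\<bar>\<theta> * (s * w b)\<bar> \<le> 1"
        using mult_mono[OF \<theta>(2) w2, of b] w0[of b] \<theta> s by (simp add: abs_mult)
    qed
    also have "(\<Sum>b\<in>A. (s * w b)\<^sup>2) = (\<Sum>b\<in>A. (w b)\<^sup>2)"
      using s by (intro sum.cong) (auto simp: power_mult_distrib abs_square_eq_1)
    also have "exp (\<theta>\<^sup>2 * q * (\<Sum>b\<in>A. (w b)\<^sup>2) - \<theta> * a) \<le>
        exp (\<theta>\<^sup>2 * q * (2 * (real (card S) * real (card V))) - \<theta> * a)"
      using sw2 q by (simp add: mult_left_mono)
    finally show ?thesis by (simp add: mult_ac)
  qed
  have "measure_pmf.prob (nonedge_pmf V q) {y. \<bar>\<Sum>v\<in>S. \<Sum>u\<in>T - {v}. of_bool (y {u, v}) - q\<bar> \<ge> a}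
     \<le> measure_pmf.prob (nonedge_pmf V q)
       ({y. (\<Sum>b\<in>A. (1 * w b) * (of_bool (y b) - q)) \<ge> a} \<union> {y. (\<Sum>b\<in>A. (- 1 * w b) * (of_bool (y b) - q)) \<ge> a})"
    by (rule measure_pmf.finite_measure_mono)
      (auto simp: grp[of "\<lambda>b. of_bool (_ b) - q"] sum_negf abs_if split: if_splits)
  also have "\<dots> \<le> measure_pmf.prob (nonedge_pmf V q) {y. (\<Sum>b\<in>A. (1 * w b) * (of_bool (y b) - q)) \<ge> a}
     + measure_pmf.prob (nonedge_pmf V q) {y. (\<Sum>b\<in>A. (- 1 * w b) * (of_bool (y b) - q)) \<ge> a}"
    by (rule measure_Un_le) auto
  also have "\<dots> \<le> 2 * exp (2 * \<theta>\<^sup>2 * q * real (card S) * real (card V) - \<theta> * a)"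
    using one[of 1] one[of "-1"] by simp
  finally show ?thesis .
qed

text \<open>Translates counts of vertices non-adjacent to \<open>u\<close> into counts of
  coordinates of the product measure.\<close>

definition star :: "'a \<Rightarrow> 'a set \<Rightarrow> 'a set set" where
  "star u T = (\<lambda>w. {u, w}) ` T"

lemma card_star_filter: "card {e \<in> star u T. y e} = card {w \<in> T. y {u, w}}"
proof -
  have "{e \<in> star u T. y e} = (\<lambda>w. {u, w}) ` {w \<in> T. y {u, w}}" by (auto simp: star_def)
  moreover have "inj_on (\<lambda>w. {u, w}) X" for X by (auto simp: inj_on_def doubleton_eq_iff)
  ultimately show ?thesis by (simp add: card_image)
qed

lemma card_star [simp]: "card (star u T) = card T"
  using card_star_filter[of u T "\<lambda>_. True"] by simp

lemma finite_star [simp]: "finite T \<Longrightarrow> finite (star u T)"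
  by (simp add: star_def)

lemma star_subset: "u \<in> V \<Longrightarrow> T \<subseteq> V - {u} \<Longrightarrow> star u T \<subseteq> all_pairs V"
  by (auto simp: star_def pair_mem_all_pairs)

text \<open>First moment: \<open>t\<close> common non-neighbours contain a \<open>t\<close>-set
  \<open>T\<close> for which two stars are missing entirely. The centres are distinct and outside
  \<open>T\<close>, so the stars are disjoint and make up 2t independent pairs.\<close>

lemma prob_codegree_le:
  assumes "finite V" "0 \<le> q" "q \<le> 1" "u \<in> V" "v \<in> V" "u \<noteq> v"
  shows "measure_pmf.prob (nonedge_pmf V q) {y. card {w \<in> V - {u, v}. y {u, w} \<and> y {v, w}} \<ge> t}
    \<le> real (card V choose t) * q ^ (2 * t)"
proof -
  let ?V = "V - {u, v}"
  have "\<exists>T\<subseteq>?V. card T = t \<and> (\<forall>e\<in>star u T \<union> star v T. y e)"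
    if "t \<le> card {w \<in> ?V. y {u, w} \<and> y {v, w}}" for y
  proof -
    from that obtain T where "T \<subseteq> {w \<in> ?V. y {u, w} \<and> y {v, w}}" "card T = t"
      by (meson obtain_subset_with_card_n)
    then show ?thesis by (intro exI[of _ T]) (auto simp: star_def)
  qed
  then have "measure_pmf.prob (nonedge_pmf V q) {y. card {w \<in> ?V. y {u, w} \<and> y {v, w}} \<ge> t} \<le>
    measure_pmf.prob (nonedge_pmf V q) {y. \<exists>T\<subseteq>?V. card T = t \<and> (\<forall>e\<in>star u T \<union> star v T. y e)}"
    by (intro measure_pmf.finite_measure_mono) auto
  also have "\<dots> \<le> real (card ?V choose t) * q ^ (2 * t)"
  proof (rule prob_union_card_le)
    fix T assume T: "T \<subseteq> ?V" "card T = t"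
    have fT: "finite T" using T assms(1) finite_subset by blast
    have "star u T \<inter> star v T = {}" using T assms(6) by (auto simp: star_def doubleton_eq_iff)
    then have "card (star u T \<union> star v T) = 2 * t"
      using fT T by (subst card_Un_disjoint) auto
    moreover have "star u T \<union> star v T \<subseteq> all_pairs V"
      using T assms by (intro Un_least star_subset) auto
    ultimately show "measure_pmf.prob (nonedge_pmf V q) {y. \<forall>e\<in>star u T \<union> star v T. y e} \<le> q ^ (2 * t)"
      unfolding nonedge_pmf_def using assms by (subst prob_all_true) auto
  qed (use assms in auto)
  also have "\<dots> \<le> real (card V choose t) * q ^ (2 * t)"
  proof (intro mult_right_mono of_nat_mono)
    show "card ?V choose t \<le> card V choose t"
      using assms(1) by (intro binomial_right_mono card_mono) auto
  qed (use assms in auto)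
  finally show ?thesis .
qed

text \<open>Conditionally on the pairs inside \<open>S\<close>, the degrees of the vertices of \<open>S\<close> are independent.\<close>

lemma prob_equal_degrees_le:
  assumes "finite V" "0 < q" "q \<le> 1/2" and S: "S \<subseteq> V" "m \<le> real (card V) - real (card S)" "m > 0"
  shows "measure_pmf.prob (nonedge_pmf V q) {y. \<forall>v\<in>S. card {w \<in> V - {v}. y {v, w}} = k}
    \<le> (6 / sqrt (m * q)) ^ card S"
proof -
  have fS: "finite S" using S assms(1) finite_subset by blast
  define B where "B = (\<lambda>v. star v (V - S))"
  define C where "C = (\<lambda>v. star v (S - {v}))"
  define g where "g = (\<lambda>v y. int k - int (card {e \<in> C v. y e}))"
  have "{y. \<forall>v\<in>S. card {w \<in> V - {v}. y {v, w}} = k} = {y. \<forall>v\<in>S. int (card {e \<in> B v. y e}) = g v y}"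
  proof -
    have "card {w \<in> V - {v}. y {v, w}} = card {e \<in> B v. y e} + card {e \<in> C v. y e}" if "v \<in> S" for v y
      unfolding B_def C_def card_star_filter using fS assms(1) S that
      by (subst card_Un_disjoint[symmetric]) (auto intro!: arg_cong[where f = card])
    then show ?thesis by (auto simp: g_def)
  qed
  also have "measure_pmf.prob (nonedge_pmf V q) \<dots> \<le> (6 / sqrt (m * q)) ^ card S"
    unfolding nonedge_pmf_def
  proof (rule prob_block_counts_le)
    show "disjoint_family_on B S"
      by (auto simp: disjoint_family_on_def B_def star_def doubleton_eq_iff)
    show "B v \<subseteq> all_pairs V" if "v \<in> S" for v
      unfolding B_def using that S by (intro star_subset) auto
    show "m \<le> real (card (B v))" if "v \<in> S" for v
    proof -
      have "card (B v) = card V - card S" using S fS by (simp add: B_def card_Diff_subset)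
      then show ?thesis using S(2,3) by linarith
    qed
    show "g v y = g v y'" if "v \<in> S" "\<And>x. x \<notin> (\<Union>w\<in>S. B w) \<Longrightarrow> y x = y' x" for v y y'
    proof -
      have "C v \<inter> (\<Union>w\<in>S. B w) = {}"
        using that(1) by (auto simp: C_def B_def star_def doubleton_eq_iff)
      then have "{e \<in> C v. y e} = {e \<in> C v. y' e}" using that(2) by blast
      then show ?thesis by (simp add: g_def)
    qed
  qed (use assms fS in auto)
  finally show ?thesis .
qed

section \<open>Properties holding with high probability\<close>

definition whp :: "(nat \<Rightarrow> 'a pmf) \<Rightarrow> (nat \<Rightarrow> 'a \<Rightarrow> bool) \<Rightarrow> bool" where
  "whp M P \<longleftrightarrow> (\<lambda>n. measure_pmf.prob (M n) {x. P n x}) \<longlonglongrightarrow> 1"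

lemma prob_not_eq: "measure_pmf.prob M {x. \<not> P x} = 1 - measure_pmf.prob M {x. P x}"
  using measure_pmf.prob_compl[of "{x. P x}" M] by (simp add: Compl_eq_Diff_UNIV[symmetric] Collect_neg_eq)

lemma whp_I:
  assumes "eventually (\<lambda>n. measure_pmf.prob (M n) {x. \<not> P n x} \<le> f n) sequentially" "f \<longlonglongrightarrow> 0"
  shows "whp M P"
  unfolding whp_def
proof (rule tendsto_sandwich)
  show "eventually (\<lambda>n. 1 - f n \<le> measure_pmf.prob (M n) {x. P n x}) sequentially"
    using assms(1) by eventually_elim (simp add: prob_not_eq)
  show "(\<lambda>n. 1 - f n) \<longlonglongrightarrow> 1" using tendsto_diff[OF tendsto_const assms(2), of 1] by simp
qed auto

lemma whp_not: "whp M P \<Longrightarrow> (\<lambda>n. measure_pmf.prob (M n) {x. \<not> P n x}) \<longlonglongrightarrow> 0"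
  unfolding whp_def prob_not_eq using tendsto_diff[OF tendsto_const, of _ 1 sequentially 1] by fastforce

lemma whp_mono:
  assumes "whp M P" "eventually (\<lambda>n. \<forall>x. P n x \<longrightarrow> Q n x) sequentially"
  shows "whp M Q"
proof (rule whp_I)
  show "eventually (\<lambda>n. measure_pmf.prob (M n) {x. \<not> Q n x} \<le> measure_pmf.prob (M n) {x. \<not> P n x}) sequentially"
    using assms(2) by eventually_elim (auto intro!: measure_pmf.finite_measure_mono)
qed (rule whp_not[OF assms(1)])

lemma whp_conj:
  assumes "whp M P" "whp M Q"
  shows "whp M (\<lambda>n x. P n x \<and> Q n x)"
proof (rule whp_I)
  show "eventually (\<lambda>n. measure_pmf.prob (M n) {x. \<not> (P n x \<and> Q n x)} \<le>
      measure_pmf.prob (M n) {x. \<not> P n x} + measure_pmf.prob (M n) {x. \<not> Q n x}) sequentially"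
  proof (intro always_eventually allI)
    fix n
    have "{x. \<not> (P n x \<and> Q n x)} = {x. \<not> P n x} \<union> {x. \<not> Q n x}" by auto
    then show "measure_pmf.prob (M n) {x. \<not> (P n x \<and> Q n x)} \<le>
      measure_pmf.prob (M n) {x. \<not> P n x} + measure_pmf.prob (M n) {x. \<not> Q n x}"
      using measure_Un_le[of "{x. \<not> P n x}" "measure_pmf (M n)" "{x. \<not> Q n x}"] by simp
  qed
  show "(\<lambda>n. measure_pmf.prob (M n) {x. \<not> P n x} + measure_pmf.prob (M n) {x. \<not> Q n x}) \<longlonglongrightarrow> 0"
    using tendsto_add[OF whp_not[OF assms(1)] whp_not[OF assms(2)]] by simp
qed

text \<open>The single term k^k/k! of the exponential series is at most exp k, so k! is at least
  (k/e)^k.\<close>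

lemma binomial_le_exp_power:
  assumes "k > 0"
  shows "real (n choose k) \<le> (exp 1 * real n / real k) ^ k"
proof -
  have "(\<Sum>i\<in>{k}. real k ^ i /\<^sub>R fact i) \<le> (\<Sum>i. real k ^ i /\<^sub>R fact i)"
    by (rule sum_le_suminf) (auto intro!: summable_exp)
  then have "real k ^ k / fact k \<le> exp (real k)"
    using sums_unique[OF exp_converges[of "real k"]] by (simp add: divide_inverse mult.commute)
  then have f: "real k ^ k \<le> exp 1 ^ k * fact k"
    by (simp add: exp_of_nat_mult[symmetric] field_simps)
  have "real (n choose k) * real k ^ k \<le> real (n choose k) * (exp 1 ^ k * fact k)"
    by (intro mult_left_mono f) auto
  also have "\<dots> = exp 1 ^ k * real ((n choose k) * fact k)" by simp
  also have "\<dots> \<le> exp 1 ^ k * real (n ^ k)"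
    by (intro mult_left_mono of_nat_mono binomial_fact_pow) auto
  also have "\<dots> = exp 1 ^ k * real n ^ k" by simp
  finally show ?thesis
    using assms by (simp add: power_divide power_mult_distrib field_simps)
qed

definition sparse_pmf :: "real \<Rightarrow> nat \<Rightarrow> (nat set \<Rightarrow> bool) pmf" where
  "sparse_pmf \<beta> n = nonedge_pmf {1..n} (real n powr (- (1 - \<beta>)))"

lemma sparse_rate:
  assumes "\<beta> < 1" "n \<ge> 1"
  shows "0 < real n powr (- (1 - \<beta>))" "0 \<le> real n powr (- (1 - \<beta>))" "real n powr (- (1 - \<beta>)) \<le> 1"
proof -
  have "real n powr (- (1 - \<beta>)) \<le> real n powr 0" using assms by (intro powr_mono) auto
  then show "0 < real n powr (- (1 - \<beta>))" "0 \<le> real n powr (- (1 - \<beta>))" "real n powr (- (1 - \<beta>)) \<le> 1"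
    using assms by auto
qed

lemma sparse_rate_mult:
  assumes "n \<ge> 1"
  shows "real n powr (- (1 - \<beta>)) * real n = real n powr \<beta>"
  using assms by (simp add: powr_mult_base mult.commute)

lemma powr_pos_at_top:
  assumes "0 < (\<beta>::real)"
  shows "filterlim (\<lambda>n. real n powr \<beta>) at_top sequentially"
  using assms by real_asymp

section \<open>Cliques, discrepancy, degrees, codegrees and degree classes\<close>

lemma whp_no_clique:
  fixes \<beta> :: real
  assumes \<beta>: "0 < \<beta>" "\<beta> < 1"
  shows "\<exists>K. whp (sparse_pmf \<beta>) (\<lambda>n y. \<forall>S\<subseteq>{1..n}. (\<forall>e\<in>all_pairs S. y e) \<longrightarrow> card S \<le> K)"
proof -
  \<comment> \<open>The expected number of cliques with k = K + 1 vertices is at most n to the power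
    k(1 - (1 - \<beta>)K/2), and this choice of \<open>K\<close> makes the exponent
    negative.\<close>
  obtain K :: nat where K: "2 / (1 - \<beta>) < real K" using reals_Archimedean2 by blast
  define k where "k = Suc K"
  have ch: "real (k choose 2) = real k * real K / 2"
  proof -
    have "even (Suc K * K)" by simp
    then show ?thesis by (simp add: k_def choose_two real_of_nat_div algebra_simps)
  qed
  define a where "a = real k - (1 - \<beta>) * real (k choose 2)"
  have "2 < (1 - \<beta>) * real K" using K \<beta> by (simp add: field_simps)
  then have "real k * 2 < real k * ((1 - \<beta>) * real K)" by (intro mult_strict_left_mono) (auto simp: k_def)
  then have a: "a < 0" by (simp add: a_def ch mult_ac)
  have "whp (sparse_pmf \<beta>) (\<lambda>n y. \<not> (\<exists>S\<subseteq>{1..n}. card S = k \<and> (\<forall>e\<in>all_pairs S. y e)))"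
  proof (rule whp_I)
    show "eventually (\<lambda>n. measure_pmf.prob (sparse_pmf \<beta> n)
      {y. \<not> \<not> (\<exists>S\<subseteq>{1..n}. card S = k \<and> (\<forall>e\<in>all_pairs S. y e))} \<le> real n powr a) sequentially"
      using eventually_ge_at_top[of 1]
    proof eventually_elim
      case (elim n)
      let ?q = "real n powr (- (1 - \<beta>))"
      have "measure_pmf.prob (sparse_pmf \<beta> n) {y. \<exists>S\<subseteq>{1..n}. card S = k \<and> (\<forall>e\<in>all_pairs S. y e)}
        \<le> real (card {1..n} choose k) * ?q ^ (k choose 2)"
        unfolding sparse_pmf_def using sparse_rate[OF \<beta>(2) elim] by (intro prob_clique_le) auto
      also have "\<dots> \<le> real n ^ k * ?q ^ (k choose 2)"
      proof (intro mult_right_mono)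
        have "(n choose k) * 1 \<le> (n choose k) * fact k" by (intro mult_left_mono) (auto simp: Suc_leI)
        also have "\<dots> \<le> n ^ k" by (rule binomial_fact_pow)
        finally show "real (card {1..n} choose k) \<le> real n ^ k" by (simp flip: of_nat_power)
      qed auto
      also have "\<dots> = real n powr a"
        using elim by (simp add: a_def powr_realpow[symmetric] powr_powr powr_add[symmetric] algebra_simps)
      finally show ?case unfolding not_not .
    qed
    show "(\<lambda>n. real n powr a) \<longlonglongrightarrow> 0"
      using a by (intro tendsto_neg_powr filterlim_real_sequentially)
  qed
  then have "whp (sparse_pmf \<beta>) (\<lambda>n y. \<forall>S\<subseteq>{1..n}. (\<forall>e\<in>all_pairs S. y e) \<longrightarrow> card S \<le> K)"
  proof (rule whp_mono, intro always_eventually allI impI)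
    fix n y S
    assume no: "\<not> (\<exists>S\<subseteq>{1..n}. card S = k \<and> (\<forall>e\<in>all_pairs S. y e))"
      and S: "S \<subseteq> {1..n}" "\<forall>e\<in>all_pairs S. y e"
    show "card S \<le> K"
    proof (rule ccontr)
      assume "\<not> card S \<le> K"
      then have "k \<le> card S" by (simp add: k_def)
      then obtain T where "T \<subseteq> S" "card T = k" by (meson obtain_subset_with_card_n)
      then show False using no S all_pairs_mono[of T S] by blast
    qed
  qed
  then show ?thesis by blast
qed

text \<open>With \<theta> = n^(-\<beta>/2) the quadratic term of the exponent is 2|S| and the linear
  one is (2 + 2/\<delta>)|S|. The constant is chosen so that -2|S|/\<delta> remains, which is at
  most -2n, and exp 2 > 4 beats the union over at most 4^n pairs.\<close>

lemma whp_discrepancy: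
  fixes \<beta> \<delta> :: real
  assumes \<beta>: "0 < \<beta>" "\<beta> < 1" and \<delta>: "0 < \<delta>"
  shows "whp (sparse_pmf \<beta>) (\<lambda>n y. \<forall>S\<subseteq>{1..n}. \<forall>T\<subseteq>{1..n}. \<delta> * real n \<le> real (card S) \<longrightarrow>
    \<bar>\<Sum>v\<in>S. \<Sum>u\<in>T - {v}. of_bool (y {u, v}) - real n powr (- (1 - \<beta>))\<bar>
      < (2 + 2 / \<delta>) * real n powr (\<beta> / 2) * real (card S))"
proof (rule whp_I)
  let ?C = "2 + 2 / \<delta>"
  define f where "f = (\<lambda>n. 4 ^ n * (2 * exp (- (2 * real n))))"
  have "f = (\<lambda>n. 2 * (4 * exp (- 2)) ^ n)"
    by (auto simp: f_def power_mult_distrib simp flip: exp_of_nat_mult)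
  moreover have "4 * exp (- 2) < (1::real)"
    using exp_lower_Taylor_quadratic[of "2::real"] by (simp add: exp_minus field_simps)
  then have "(\<lambda>n. 2 * (4 * exp (- 2 :: real)) ^ n) \<longlonglongrightarrow> 2 * 0"
    by (intro tendsto_mult tendsto_const LIMSEQ_realpow_zero) auto
  ultimately show "f \<longlonglongrightarrow> 0" by simp
  \<comment> \<open>This makes \<theta> at most 1/2, as the weights up to 2 demand.\<close>
  have "eventually (\<lambda>n. real n powr (\<beta> / 2) \<ge> 2) sequentially"
    using powr_pos_at_top[of "\<beta> / 2"] \<beta> by (simp add: filterlim_at_top)
  then show "eventually (\<lambda>n. measure_pmf.prob (sparse_pmf \<beta> n) {y. \<not> (\<forall>S\<subseteq>{1..n}. \<forall>T\<subseteq>{1..n}.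
    \<delta> * real n \<le> real (card S) \<longrightarrow>
    \<bar>\<Sum>v\<in>S. \<Sum>u\<in>T - {v}. of_bool (y {u, v}) - real n powr (- (1 - \<beta>))\<bar>
      < ?C * real n powr (\<beta> / 2) * real (card S))} \<le> f n) sequentially"
    using eventually_ge_at_top[of 1]
  proof eventually_elim
    case (elim n)
    let ?q = "real n powr (- (1 - \<beta>))"
    define \<theta> where "\<theta> = real n powr (- (\<beta> / 2))"
    have \<theta>: "0 < \<theta>" "\<theta> \<le> 1/2"
      using elim by (auto simp: \<theta>_def powr_minus field_simps)
    define P where "P = (\<lambda>(S :: nat set, T) y. \<bar>\<Sum>v\<in>S. \<Sum>u\<in>T - {v}. of_bool (y {u, v}) - ?q\<bar>
      \<ge> ?C * real n powr (\<beta> / 2) * real (card S))"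
    define I where "I = {S. S \<subseteq> {1..n} \<and> \<delta> * real n \<le> real (card S)} \<times> Pow {1..n}"
    have "{y. \<not> (\<forall>S\<subseteq>{1..n}. \<forall>T\<subseteq>{1..n}. \<delta> * real n \<le> real (card S) \<longrightarrow>
      \<bar>\<Sum>v\<in>S. \<Sum>u\<in>T - {v}. of_bool (y {u, v}) - ?q\<bar> < ?C * real n powr (\<beta> / 2) * real (card S))}
      = {y. \<exists>i\<in>I. P i y}"
      unfolding I_def P_def Bex_def by (intro Collect_cong) (auto simp only: not_all not_imp not_less split_paired_Ex mem_Times_iff fst_conv snd_conv mem_Collect_eq Pow_iff prod.case)
    also have "measure_pmf.prob (sparse_pmf \<beta> n) \<dots> \<le> real (card I) * (2 * exp (- (2 * real n)))"
    proof (rule prob_ball_union_le)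
      show "finite I" by (auto simp: I_def)
      fix i assume "i \<in> I"
      then obtain S T where i: "i = (S, T)" "S \<subseteq> {1..n}" "T \<subseteq> {1..n}" "\<delta> * real n \<le> real (card S)"
        by (auto simp: I_def)
      have "measure_pmf.prob (sparse_pmf \<beta> n) {y. P i y} \<le>
        2 * exp (2 * \<theta>\<^sup>2 * ?q * real (card S) * real (card {1..n}) - \<theta> * (?C * real n powr (\<beta> / 2) * real (card S)))"
        unfolding sparse_pmf_def P_def i prod.case
        using i sparse_rate[OF \<beta>(2) elim(2)] by (intro prob_discrepancy_le \<theta>) auto
      also have "2 * \<theta>\<^sup>2 * ?q * real (card S) * real (card {1..n}) = 2 * (\<theta>\<^sup>2 * (?q * real n)) * real (card S)"
        by simp
      also have "\<theta>\<^sup>2 * (?q * real n) = 1"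
        unfolding sparse_rate_mult[OF elim(2)] \<theta>_def power2_eq_square
        using elim(2) by (simp add: powr_add[symmetric])
      also have "\<theta> * (?C * real n powr (\<beta> / 2) * real (card S)) = ?C * real (card S)"
        using elim(2) by (simp add: \<theta>_def powr_minus)
      also have "2 * 1 * real (card S) - ?C * real (card S) = - (2 / \<delta> * real (card S))"
        by (simp add: algebra_simps)
      also have "2 * exp (- (2 / \<delta> * real (card S))) \<le> 2 * exp (- (2 * real n))"
        using i(4) \<delta> by (simp add: field_simps)
      finally show "measure_pmf.prob (sparse_pmf \<beta> n) {y. P i y} \<le> 2 * exp (- (2 * real n))" .
    qed
    also have "\<dots> \<le> f n"
      unfolding f_def
    proof (intro mult_right_mono)
      have "card I \<le> card (Pow {1..n} \<times> Pow {1..n})"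
        unfolding I_def by (intro card_mono) auto
      also have "\<dots> = 4 ^ n" by (simp add: card_cartesian_product card_Pow flip: power_mult_distrib)
      finally show "real (card I) \<le> 4 ^ n" by (simp flip: of_nat_power)
    qed auto
    finally show ?case .
  qed
qed

lemma whp_degree_upper:
  fixes \<beta> :: real
  assumes \<beta>: "0 < \<beta>" "\<beta> < 1"
  shows "whp (sparse_pmf \<beta>) (\<lambda>n y. \<forall>u\<in>{1..n}. real (card {w \<in> {1..n} - {u}. y {u, w}}) < 2 * real n powr \<beta>)"
proof (rule whp_I)
  define f where "f = (\<lambda>n. real n * exp (- (real n powr \<beta>) / 4))"
  show "f \<longlonglongrightarrow> 0" unfolding f_def using \<beta> by real_asymp
  show "eventually (\<lambda>n. measure_pmf.prob (sparse_pmf \<beta> n)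
    {y. \<not> (\<forall>u\<in>{1..n}. real (card {w \<in> {1..n} - {u}. y {u, w}}) < 2 * real n powr \<beta>)} \<le> f n) sequentially"
    using eventually_ge_at_top[of 1]
  proof eventually_elim
    case (elim n)
    let ?q = "real n powr (- (1 - \<beta>))"
    have "measure_pmf.prob (sparse_pmf \<beta> n)
      {y. \<exists>u\<in>{1..n}. 2 * real n powr \<beta> \<le> real (card {e \<in> star u ({1..n} - {u}). y e})}
      \<le> real (card {1..n}) * exp (- (real n powr \<beta>) / 4)"
    proof (rule prob_ball_union_le)
      fix u assume u: "u \<in> {1..n}"
      have "?q * real (card ({1..n} - {u})) \<le> ?q * real n"
        using card_mono[of "{1..n}" "{1..n} - {u}"] by (intro mult_left_mono) auto
      then have deg: "?q * real (card (star u ({1..n} - {u}))) \<le> real n powr \<beta>"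
        unfolding sparse_rate_mult[OF elim] card_star .
      show "measure_pmf.prob (sparse_pmf \<beta> n)
         {y. 2 * real n powr \<beta> \<le> real (card {e \<in> star u ({1..n} - {u}). y e})}
        \<le> exp (- (real n powr \<beta>) / 4)"
        unfolding sparse_pmf_def nonedge_pmf_def using sparse_rate[OF \<beta>(2) elim] u
        by (intro prob_count_upper[OF _ _ _ _ deg] star_subset) auto
    qed auto
    then show ?case by (simp add: f_def card_star_filter not_less)
  qed
qed

lemma whp_degree_lower:
  fixes \<beta> :: real and A :: "nat \<Rightarrow> nat \<Rightarrow> nat set"
  assumes \<beta>: "0 < \<beta>" "\<beta> < 1" and r: "r > 0"
    and A: "\<And>n i. i < r \<Longrightarrow> A n i \<subseteq> {1..n}" "\<And>n i. i < r \<Longrightarrow> real (card (A n i)) \<ge> real n / real r - 1"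
  shows "whp (sparse_pmf \<beta>) (\<lambda>n y. \<forall>u\<in>{1..n}. \<forall>i<r.
    real n powr \<beta> / (4 * real r) < real (card {w \<in> A n i - {u}. y {u, w}}))"
proof (rule whp_I)
  define f where "f = (\<lambda>n. real (n * r) * exp (- (real n powr \<beta>) / (32 * real r)))"
  show "f \<longlonglongrightarrow> 0" unfolding f_def using \<beta> r by real_asymp
  show "eventually (\<lambda>n. measure_pmf.prob (sparse_pmf \<beta> n)
    {y. \<not> (\<forall>u\<in>{1..n}. \<forall>i<r. real n powr \<beta> / (4 * real r) < real (card {w \<in> A n i - {u}. y {u, w}}))}
      \<le> f n) sequentially"
    using eventually_ge_at_top[of 1] eventually_ge_at_top[of "4 * r"]
  proof eventually_elim
    case (elim n)
    let ?q = "real n powr (- (1 - \<beta>))"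
    define B where "B = (\<lambda>(u, i). star u (A n i - {u}))"
    define I where "I = {1..n} \<times> {..<r}"
    have "measure_pmf.prob (sparse_pmf \<beta> n)
      {y. \<exists>x\<in>I. real (card {e \<in> B x. y e}) \<le> real n powr \<beta> / (4 * real r)}
      \<le> real (card I) * exp (- (real n powr \<beta>) / (32 * real r))"
    proof (rule prob_ball_union_le)
      show "finite I" by (simp add: I_def)
      fix x assume "x \<in> I"
      then obtain u i where x: "x = (u, i)" "u \<in> {1..n}" "i < r" by (auto simp: I_def)
      have BV: "B x \<subseteq> all_pairs {1..n}" unfolding B_def x prod.case
        using A(1)[OF x(3)] x(2) by (intro star_subset) auto
      \<comment> \<open>One unit is lost to the rounding of the blocks and one to \<open>u\<close>;
        from n \<ge> 4r on, n/(2r) vertices remain. The mean is then at least n^\<beta>/(2r), and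
        half of it is the asserted bound.\<close>
      have "real (card (A n i - {u})) \<ge> real (card (A n i)) - 1"
        using diff_card_le_card_Diff[of "{u}" "A n i"] by simp
      then have "real (card (A n i - {u})) \<ge> real n / real r - 2" using A(2)[OF x(3), of n] by linarith
      moreover have "real n / real r \<ge> 4"
        using of_nat_mono[OF elim(2), where 'a = real] r by (simp add: field_simps)
      moreover have "real n / (2 * real r) = (real n / real r) / 2" by simp
      ultimately have cB: "real (card (B x)) \<ge> real n / (2 * real r)" by (simp add: B_def x)
      have "?q * real (card (B x)) \<ge> ?q * (real n / (2 * real r))"
        by (intro mult_left_mono cB) auto
      then have qB: "?q * real (card (B x)) \<ge> real n powr \<beta> / (2 * real r)"
        using sparse_rate_mult[OF elim(1), of \<beta>] by simp
      have "measure_pmf.prob (sparse_pmf \<beta> n) {y. real (card {e \<in> B x. y e}) \<le> real n powr \<beta> / (4 * real r)}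
        \<le> measure_pmf.prob (sparse_pmf \<beta> n) {y. real (card {e \<in> B x. y e}) \<le> ?q * real (card (B x)) / 2}"
        using qB by (intro measure_pmf.finite_measure_mono) auto
      also have "\<dots> \<le> exp (- (?q * real (card (B x))) / 16)"
        unfolding sparse_pmf_def nonedge_pmf_def
        using sparse_rate[OF \<beta>(2) elim(1)] BV by (intro prob_count_lower) auto
      also have "\<dots> \<le> exp (- (real n powr \<beta>) / (32 * real r))"
        using qB by simp
      finally show "measure_pmf.prob (sparse_pmf \<beta> n) {y. real (card {e \<in> B x. y e}) \<le> real n powr \<beta> / (4 * real r)}
        \<le> exp (- (real n powr \<beta>) / (32 * real r))" .
    qed
    moreover have "{y. \<exists>x\<in>I. real (card {e \<in> B x. y e}) \<le> real n powr \<beta> / (4 * real r)} =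
      {y. \<not> (\<forall>u\<in>{1..n}. \<forall>i<r. real n powr \<beta> / (4 * real r) < real (card {w \<in> A n i - {u}. y {u, w}}))}"
      by (auto simp: I_def B_def card_star_filter not_less Bex_def)
    ultimately show ?case by (simp add: f_def I_def)
  qed
qed

text \<open>The mean is of order n^(2\<beta>-1), below n^\<beta> by the factor n^(\<beta>-1) that
  tends to 0; hence any \<open>c > 0\<close> is possible. For t of size about c n^\<beta> the first
  moment is (e n q^2/t)^t, with a base at most 1/e once n^(\<beta>-1) < c exp(-2).\<close>

lemma whp_codegree:
  fixes \<beta> c :: real
  assumes \<beta>: "0 < \<beta>" "\<beta> < 1" and c: "c > 0"
  shows "whp (sparse_pmf \<beta>) (\<lambda>n y. \<forall>u\<in>{1..n}. \<forall>v\<in>{1..n}. u \<noteq> v \<longrightarrow>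
    real (card {w \<in> {1..n} - {u, v}. y {u, w} \<and> y {v, w}}) < c * real n powr \<beta>)"
proof (rule whp_I)
  define f where "f = (\<lambda>n. real n ^ 2 * exp (- (c * real n powr \<beta>)))"
  show "f \<longlonglongrightarrow> 0" unfolding f_def using \<beta> c by real_asymp
  have "((\<lambda>n. real n powr (\<beta> - 1)) \<longlongrightarrow> 0) sequentially"
    using \<beta> by (intro tendsto_neg_powr filterlim_real_sequentially) auto
  then have ev: "eventually (\<lambda>n. real n powr (\<beta> - 1) < c * exp (- 2)) sequentially"
    using c by (intro order_tendstoD) auto
  show "eventually (\<lambda>n. measure_pmf.prob (sparse_pmf \<beta> n)
    {y. \<not> (\<forall>u\<in>{1..n}. \<forall>v\<in>{1..n}. u \<noteq> v \<longrightarrow>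
    real (card {w \<in> {1..n} - {u, v}. y {u, w} \<and> y {v, w}}) < c * real n powr \<beta>)} \<le> f n) sequentially"
    using eventually_ge_at_top[of 1] ev
  proof eventually_elim
    case (elim n)
    let ?q = "real n powr (- (1 - \<beta>))"
    define t where "t = nat \<lceil>c * real n powr \<beta>\<rceil>"
    have cn: "c * real n powr \<beta> > 0" using c elim by simp
    have t: "real t \<ge> c * real n powr \<beta>" "t > 0"
      using cn unfolding t_def by (auto simp: real_nat_ceiling_ge)
    define I where "I = {(u, v). u \<in> {1..n} \<and> v \<in> {1..n} \<and> u \<noteq> v}"
    define P where "P = (\<lambda>(u, v) y. t \<le> card {w \<in> {1..n} - {u, v}. y {u, w} \<and> y {v, w}})"
    have IS: "I \<subseteq> {1..n} \<times> {1..n}" by (auto simp: I_def)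
    have base: "real (n choose t) * ?q ^ (2 * t) \<le> exp (- (c * real n powr \<beta>))"
    proof -
      have "real (n choose t) * ?q ^ (2 * t) \<le> (exp 1 * real n / real t) ^ t * ?q ^ (2 * t)"
        by (intro mult_right_mono binomial_le_exp_power t) auto
      also have "\<dots> = (exp 1 * real n / real t * ?q\<^sup>2) ^ t"
        by (simp only: power_mult power_mult_distrib)
      also have "\<dots> \<le> exp (- 1) ^ t"
      proof (intro power_mono)
        have "exp 1 * real n / real t * ?q\<^sup>2 \<le> exp 1 * real n / (c * real n powr \<beta>) * ?q\<^sup>2"
          using t cn by (intro mult_right_mono divide_left_mono) auto
        also have "\<dots> = exp 1 / c * ((?q * real n) * ?q / real n powr \<beta>)"
          by (simp add: power2_eq_square)
        also have "(?q * real n) * ?q / real n powr \<beta> = real n powr (\<beta> - 1)"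
          unfolding sparse_rate_mult[OF elim(1)] using elim(1) by simp
        also have "exp 1 / c * real n powr (\<beta> - 1) \<le> exp 1 / c * (c * exp (- 2))"
          using elim c by (intro mult_left_mono) auto
        also have "\<dots> = exp (- 1)" using c by (simp flip: exp_add)
        finally show "exp 1 * real n / real t * ?q\<^sup>2 \<le> exp (- 1)" .
      qed auto
      also have "\<dots> = exp (- real t)" by (simp flip: exp_of_nat_mult)
      also have "\<dots> \<le> exp (- (c * real n powr \<beta>))" using t by simp
      finally show ?thesis .
    qed
    have "measure_pmf.prob (sparse_pmf \<beta> n) {y. \<exists>i\<in>I. P i y} \<le> real (card I) * exp (- (c * real n powr \<beta>))"
    proof (rule prob_ball_union_le)
      show "finite I" using IS by (rule finite_subset) auto
      fix i assume "i \<in> I"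
      then obtain u v where i: "i = (u, v)" "u \<in> {1..n}" "v \<in> {1..n}" "u \<noteq> v" by (auto simp: I_def)
      have "measure_pmf.prob (sparse_pmf \<beta> n) {y. P i y} \<le> real (card {1..n} choose t) * ?q ^ (2 * t)"
        unfolding sparse_pmf_def P_def i prod.case
        using sparse_rate[OF \<beta>(2) elim(1)] i by (intro prob_codegree_le) auto
      then show "measure_pmf.prob (sparse_pmf \<beta> n) {y. P i y} \<le> exp (- (c * real n powr \<beta>))"
        using base by simp
    qed
    also have "\<dots> \<le> f n"
      unfolding f_def
    proof (intro mult_right_mono)
      have "card I \<le> card ({1..n} \<times> {1..n})" using IS by (intro card_mono) auto
      then show "real (card I) \<le> real n ^ 2"
        by (simp add: card_cartesian_product power2_eq_square flip: of_nat_mult)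
    qed auto
    finally have bound: "measure_pmf.prob (sparse_pmf \<beta> n) {y. \<exists>i\<in>I. P i y} \<le> f n" .
    have sub: "{y. \<not> (\<forall>u\<in>{1..n}. \<forall>v\<in>{1..n}. u \<noteq> v \<longrightarrow>
      real (card {w \<in> {1..n} - {u, v}. y {u, w} \<and> y {v, w}}) < c * real n powr \<beta>)} \<subseteq> {y. \<exists>i\<in>I. P i y}"
      by (fastforce simp: I_def P_def t_def not_less nat_le_iff ceiling_le_iff)
    show ?case by (rule order_trans[OF measure_pmf.finite_measure_mono[OF sub] bound]) simp
  qed
qed

text \<open>A prescribed degree has probability O(n^(-\<beta>/2)), so classes should have order
  n^(1-\<beta>/2). For a set of this size the degrees keep enough independent randomness outside the
  set for a union bound over all such sets.\<close>

lemma whp_degree_classes: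
  fixes \<beta> :: real
  assumes \<beta>: "0 < \<beta>" "\<beta> < 1"
  shows "whp (sparse_pmf \<beta>) (\<lambda>n y. \<forall>k. real (card {v\<in>{1..n}. card {w \<in> {1..n} - {v}. y {v, w}} = k})
    < 54 * real n powr (1 - \<beta> / 2) + 1)"
proof (rule whp_I)
  define f where "f = (\<lambda>n. (real n + 1) * exp (- (27 * real n powr (1 - \<beta> / 2))))"
  show "f \<longlonglongrightarrow> 0" unfolding f_def using \<beta> by real_asymp
  \<comment> \<open>This gives \<open>s \<le> n / 2\<close>, so every vertex of an
    \<open>s\<close>-set still has at least n/2 pairs leading out of the set. The second condition
    meets the restriction to rates up to 1/2 in the binomial bound.\<close>
  have ev1: "eventually (\<lambda>n. 54 * real n powr (1 - \<beta> / 2) + 1 \<le> real n / 2) sequentially"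
    using \<beta> by real_asymp
  have ev2: "eventually (\<lambda>n. real n powr (- (1 - \<beta>)) \<le> 1 / 2) sequentially"
    using \<beta> by real_asymp
  show "eventually (\<lambda>n. measure_pmf.prob (sparse_pmf \<beta> n)
    {y. \<not> (\<forall>k. real (card {v\<in>{1..n}. card {w \<in> {1..n} - {v}. y {v, w}} = k})
    < 54 * real n powr (1 - \<beta> / 2) + 1)} \<le> f n) sequentially"
    using eventually_ge_at_top[of 1] ev1 ev2
  proof eventually_elim
    case (elim n)
    let ?q = "real n powr (- (1 - \<beta>))"
    let ?D = "54 * real n powr (1 - \<beta> / 2)"
    define s where "s = nat \<lceil>?D\<rceil>"
    have D: "?D > 0" using elim by simp
    have s: "real s \<ge> ?D" "s > 0" "real s \<le> ?D + 1"
      using D unfolding s_def by (auto simp: real_nat_ceiling_ge)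
    define P where "P = (\<lambda>k y. \<exists>S\<subseteq>{1..n}. card S = s \<and> (\<forall>v\<in>S. card {w \<in> {1..n} - {v}. y {v, w}} = k))"
    have c: "real (n choose s) * (6 / sqrt (real n / 2 * ?q)) ^ s \<le> exp (- (27 * real n powr (1 - \<beta> / 2)))"
    proof -
      have "sqrt (real n / 2 * ?q) = sqrt (real n powr \<beta> / 2)"
        using sparse_rate_mult[OF elim(1), of \<beta>] by (simp add: mult.commute)
      also have "\<dots> = real n powr (\<beta> / 2) / sqrt 2"
        using elim by (simp add: real_sqrt_divide powr_half_sqrt[symmetric] powr_powr)
      finally have sq: "6 / sqrt (real n / 2 * ?q) = 6 * sqrt 2 / real n powr (\<beta> / 2)" by simp
      have "real (n choose s) * (6 / sqrt (real n / 2 * ?q)) ^ s \<le>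
          (exp 1 * real n / real s) ^ s * (6 / sqrt (real n / 2 * ?q)) ^ s"
        by (intro mult_right_mono binomial_le_exp_power s) auto
      also have "\<dots> = (exp 1 * real n / real s * (6 * sqrt 2 / real n powr (\<beta> / 2))) ^ s"
        by (simp only: sq power_mult_distrib)
      also have "\<dots> \<le> exp (- (1 / 2)) ^ s"
      proof (intro power_mono)
        \<comment> \<open>The constant 54 = 6 * 9 turns the base into e sqrt 2 / 9, which is at most
          1/2 and hence below exp(-1/2).\<close>
        have "exp 1 * real n / real s * (6 * sqrt 2 / real n powr (\<beta> / 2)) \<le>
          exp 1 * real n / ?D * (6 * sqrt 2 / real n powr (\<beta> / 2))"
          by (intro mult_right_mono divide_left_mono mult_pos_pos s(1) D) (use s(2) in auto)
        also have "\<dots> = exp 1 * sqrt 2 / 9 * (real n / (real n powr (1 - \<beta> / 2) * real n powr (\<beta> / 2)))"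
          by (simp add: mult_ac)
        also have "real n powr (1 - \<beta> / 2) * real n powr (\<beta> / 2) = real n"
          using elim by (simp flip: powr_add)
        also have "exp 1 * sqrt 2 / 9 * (real n / real n) = exp 1 * sqrt 2 / 9" using elim by simp
        also have "\<dots> \<le> 3 * (3 / 2) / 9"
        proof (intro divide_right_mono mult_mono)
          have "sqrt 2 \<le> sqrt ((3/2)\<^sup>2)" by (intro real_sqrt_le_mono) (simp add: power2_eq_square)
          then show "sqrt 2 \<le> 3 / 2" by simp
        qed (auto simp: exp_le)
        also have "\<dots> \<le> exp (- (1 / 2))" using exp_ge_add_one_self[of "- (1 / 2)"] by simp
        finally show "exp 1 * real n / real s * (6 * sqrt 2 / real n powr (\<beta> / 2)) \<le> exp (- (1 / 2))" .
      qed auto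
      also have "\<dots> = exp (- (real s / 2))" by (simp flip: exp_of_nat_mult)
      also have "\<dots> \<le> exp (- (27 * real n powr (1 - \<beta> / 2)))" using s by simp
      finally show ?thesis .
    qed
    have "measure_pmf.prob (sparse_pmf \<beta> n) {y. \<exists>k\<in>{..n}. P k y} \<le>
        real (card {..n}) * exp (- (27 * real n powr (1 - \<beta> / 2)))"
    proof (rule prob_ball_union_le)
      fix k
      have "measure_pmf.prob (sparse_pmf \<beta> n) {y. P k y} \<le>
        real (card {1..n} choose s) * (6 / sqrt (real n / 2 * ?q)) ^ s"
        unfolding P_def
      proof (rule prob_union_card_le)
        fix S assume S: "S \<subseteq> {1..n}" "card S = s"
        show "measure_pmf.prob (sparse_pmf \<beta> n) {y. \<forall>v\<in>S. card {w \<in> {1..n} - {v}. y {v, w}} = k}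
          \<le> (6 / sqrt (real n / 2 * ?q)) ^ s"
          unfolding sparse_pmf_def S(2)[symmetric]
          using S s elim sparse_rate[OF \<beta>(2) elim(1)] by (intro prob_equal_degrees_le) auto
      qed auto
      then show "measure_pmf.prob (sparse_pmf \<beta> n) {y. P k y} \<le> exp (- (27 * real n powr (1 - \<beta> / 2)))"
        using c by simp
    qed auto
    also have "\<dots> = f n" by (simp add: f_def)
    finally have bound: "measure_pmf.prob (sparse_pmf \<beta> n) {y. \<exists>k\<in>{..n}. P k y} \<le> f n" .
    have sub: "{y. \<not> (\<forall>k. real (card {v\<in>{1..n}. card {w \<in> {1..n} - {v}. y {v, w}} = k}) < ?D + 1)}
      \<subseteq> {y. \<exists>k\<in>{..n}. P k y}"
    proof
      fix y assume "y \<in> {y. \<not> (\<forall>k. real (card {v\<in>{1..n}. card {w \<in> {1..n} - {v}. y {v, w}} = k}) < ?D + 1)}"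
      then obtain k where k: "real (card {v\<in>{1..n}. card {w \<in> {1..n} - {v}. y {v, w}} = k}) \<ge> ?D + 1"
        by (auto simp: not_less)
      then have "s \<le> card {v\<in>{1..n}. card {w \<in> {1..n} - {v}. y {v, w}} = k}" using s by linarith
      then obtain S where S: "S \<subseteq> {v\<in>{1..n}. card {w \<in> {1..n} - {v}. y {v, w}} = k}" "card S = s"
        by (meson obtain_subset_with_card_n)
      then have P: "P k y" unfolding P_def by (intro exI[of _ S]) auto
      \<comment> \<open>A nonempty \<open>S\<close> shows that \<open>k\<close> is a degree, hence
        at most \<open>n\<close>; so n + 1 values suffice in the union bound.\<close>
      obtain v where "v \<in> S" using S(2) s(2) by fastforce
      then have "k = card {w \<in> {1..n} - {v}. y {v, w}}" using S by auto
      also have "\<dots> \<le> card {1..n}" by (intro card_mono) auto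
      finally show "y \<in> {y. \<exists>k\<in>{..n}. P k y}" using P by auto
    qed
    show ?case by (rule order_trans[OF measure_pmf.finite_measure_mono[OF sub] bound]) simp
  qed
qed

section \<open>The two bounds\<close>

lemma complement_graph_subset: "complement_graph V y \<subseteq> all_pairs V"
  by (auto simp: complement_graph_def)

lemma neighborhood_complement_graph:
  "v \<in> V \<Longrightarrow> neighborhood (complement_graph V y) v = {u \<in> V - {v}. \<not> y {u, v}}"
  by (auto simp: neighborhood_def complement_graph_def pair_mem_all_pairs)

lemma nonneighborhood_complement_graph:
  "v \<in> V \<Longrightarrow> nonneighborhood V (complement_graph V y) v = insert v {w \<in> V - {v}. y {v, w}}"
  by (auto simp: nonneighborhood_def neighborhood_complement_graph insert_commute)

text \<open>Passes from sums over sets to single vertices: vertices that deviate by more than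
  \<open>s\<close> in one direction cannot cancel, so \<delta>|V| of them would contradict
  \<open>disc\<close>. The two directions give the factor 2.\<close>

lemma degree_deviation_set_small:
  fixes q s \<delta> :: real
  assumes fin: "finite V" and q: "0 \<le> q" "q \<le> 1" and T: "T \<subseteq> V" and d: "\<delta> * real (card V) > 0"
    and disc: "\<And>S. S \<subseteq> V \<Longrightarrow> \<delta> * real (card V) \<le> real (card S) \<Longrightarrow>
      \<bar>\<Sum>v\<in>S. \<Sum>u\<in>T - {v}. of_bool (y {u, v}) - q\<bar> < s * real (card S)"
  shows "real (card {v\<in>V. \<bar>real (card (neighborhood (complement_graph V y) v \<inter> T)) - (1 - q) * real (card T)\<bar> > s + 1})
    \<le> 2 * \<delta> * real (card V)"
proof -
  define X where "X = (\<lambda>v. \<Sum>u\<in>T - {v}. of_bool (y {u, v}) - q)"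
  define Sp Sm where "Sp = {v\<in>V. X v > s}" and "Sm = {v\<in>V. X v < - s}"
  have fT: "finite T" using T fin finite_subset by blast
  have "real (card Sp) < \<delta> * real (card V)"
  proof (rule ccontr)
    assume "\<not> ?thesis"
    then have big: "\<delta> * real (card V) \<le> real (card Sp)" by simp
    have "s * real (card Sp) = (\<Sum>v\<in>Sp. s)" by simp
    also have "\<dots> \<le> (\<Sum>v\<in>Sp. X v)" by (intro sum_mono) (auto simp: Sp_def)
    finally show False using disc[OF _ big] unfolding X_def[symmetric] by (auto simp: Sp_def)
  qed
  moreover have "real (card Sm) < \<delta> * real (card V)"
  proof (rule ccontr)
    assume "\<not> ?thesis"
    then have big: "\<delta> * real (card V) \<le> real (card Sm)" by simp
    have "(\<Sum>v\<in>Sm. X v) \<le> (\<Sum>v\<in>Sm. - s)" by (intro sum_mono) (auto simp: Sm_def)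
    also have "\<dots> = - (s * real (card Sm))" by simp
    finally show False using disc[OF _ big] unfolding X_def[symmetric] by (auto simp: Sm_def)
  qed
  moreover have "{v\<in>V. \<bar>real (card (neighborhood (complement_graph V y) v \<inter> T)) - (1 - q) * real (card T)\<bar> > s + 1}
    \<subseteq> Sp \<union> Sm"
  proof
    fix v assume v: "v \<in> {v\<in>V. \<bar>real (card (neighborhood (complement_graph V y) v \<inter> T)) - (1 - q) * real (card T)\<bar> > s + 1}"
    let ?N = "neighborhood (complement_graph V y) v \<inter> T" and ?Y = "{u \<in> T - {v}. y {u, v}}"
    have "?N \<union> ?Y = T - {v}" "?N \<inter> ?Y = {}"
      using T v by (auto simp: neighborhood_complement_graph)
    then have "card ?N + card ?Y = card (T - {v})"
      using fT card_Un_disjoint[of ?N ?Y] by simp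
    then have c: "real (card ?N) + real (card ?Y) = real (card (T - {v}))" by linarith
    have "X v = real (card ?Y) - q * real (card (T - {v}))"
      unfolding X_def using sum_centred[of "T - {v}" "\<lambda>u. y {u, v}" q] fT by simp
    then have X: "X v = (1 - q) * real (card (T - {v})) - real (card ?N)"
      using c by (simp add: algebra_simps)
    \<comment> \<open>Removing \<open>v\<close> from \<open>T\<close> shifts the centre by at most 1
      - q, which accounts for the \<open>+ 1\<close> in the window.\<close>
    have "card T \<le> card (T - {v}) + 1" "card (T - {v}) \<le> card T"
      using fT by (auto simp: card_Diff_singleton_if)
    then have k: "real (card T) - 1 \<le> real (card (T - {v}))" "real (card (T - {v})) \<le> real (card T)" by linarith+
    have "(1 - q) * (real (card T) - 1) \<le> (1 - q) * real (card (T - {v}))"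
      "(1 - q) * real (card (T - {v})) \<le> (1 - q) * real (card T)"
      using k q by (auto intro: mult_left_mono)
    then have "(1 - q) * real (card T) - 1 \<le> (1 - q) * real (card (T - {v}))"
      "(1 - q) * real (card (T - {v})) \<le> (1 - q) * real (card T)"
      using q by (auto simp: algebra_simps)
    then show "v \<in> Sp \<union> Sm" using v X by (auto simp: Sp_def Sm_def abs_if split: if_splits)
  qed
  then have "card {v\<in>V. \<bar>real (card (neighborhood (complement_graph V y) v \<inter> T)) - (1 - q) * real (card T)\<bar> > s + 1}
     \<le> card (Sp \<union> Sm)"
    using fin by (intro card_mono) (auto simp: Sp_def Sm_def)
  moreover have "card (Sp \<union> Sm) \<le> card Sp + card Sm" by (rule card_Un_le)
  ultimately show ?thesis by linarith
qed

lemma whp_lower_bound: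
  fixes \<beta> :: real
  assumes \<beta>: "0 < \<beta>" "\<beta> < 1"
  shows "whp (sparse_pmf \<beta>) (\<lambda>n y. 2 / \<beta> \<le> real (multiset_chromatic_number {1..n} (complement_graph {1..n} y)))"
proof -
  obtain K where K: "whp (sparse_pmf \<beta>) (\<lambda>n y. \<forall>S\<subseteq>{1..n}. (\<forall>e\<in>all_pairs S. y e) \<longrightarrow> card S \<le> K)"
    using whp_no_clique[OF \<beta>] by blast
  \<comment> \<open>The largest integer strictly below 2/\<beta>, also when 2/\<beta> is an integer.
    A colouring violating the bound has at most \<open>L\<close> parts, and \<beta>L/2 < 1.\<close>
  define L where "L = nat (\<lceil>2 / \<beta>\<rceil> - 1)"
  have "2 / \<beta> > 0" using \<beta> by simp
  then have Lc: "real L = of_int \<lceil>2 / \<beta>\<rceil> - 1" unfolding L_def by (simp add: zero_less_ceiling le_less_Suc_eq of_nat_nat)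
  have "real L < 2 / \<beta>" unfolding Lc by linarith
  then have L\<beta>: "\<beta> / 2 * real L - 1 < 0" using \<beta> by (simp add: field_simps)
  \<comment> \<open>With at most \<open>L\<close> parts and 2\<delta>|V| deviating vertices for
    each, at most half of \<open>V\<close> is lost.\<close>
  define \<delta> where "\<delta> = 1 / (4 * (real L + 1))"
  have \<delta>: "\<delta> > 0" by (simp add: \<delta>_def)
  define C where "C = 2 + 2 / \<delta>"
  have C: "C > 0" using \<delta> by (simp add: C_def add_pos_pos)
  have "(\<lambda>n. 2 * real K * (2 * C + 3) ^ L * real n powr (\<beta> / 2 * real L - 1)) \<longlonglongrightarrow> 2 * real K * (2 * C + 3) ^ L * 0"
    by (intro tendsto_mult tendsto_const tendsto_neg_powr L\<beta> filterlim_real_sequentially)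
  then have ev: "eventually (\<lambda>n. 2 * real K * (2 * C + 3) ^ L * real n powr (\<beta> / 2 * real L - 1) < 1) sequentially"
    by (intro order_tendstoD(2)) auto
  show ?thesis
  proof (rule whp_mono[OF whp_conj[OF K whp_discrepancy[OF \<beta> \<delta>]]])
    show "eventually (\<lambda>n. \<forall>y. (\<forall>S\<subseteq>{1..n}. (\<forall>e\<in>all_pairs S. y e) \<longrightarrow> card S \<le> K) \<and>
      (\<forall>S\<subseteq>{1..n}. \<forall>T\<subseteq>{1..n}. \<delta> * real n \<le> real (card S) \<longrightarrow>
      \<bar>\<Sum>v\<in>S. \<Sum>u\<in>T - {v}. of_bool (y {u, v}) - real n powr (- (1 - \<beta>))\<bar>
        < (2 + 2 / \<delta>) * real n powr (\<beta> / 2) * real (card S)) \<longrightarrow>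
      2 / \<beta> \<le> real (multiset_chromatic_number {1..n} (complement_graph {1..n} y))) sequentially"
      using eventually_ge_at_top[of 1] ev
    proof (eventually_elim, intro allI impI, elim conjE)
      fix n :: nat and y :: "nat set \<Rightarrow> bool"
      assume n: "1 \<le> n" and small: "2 * real K * (2 * C + 3) ^ L * real n powr (\<beta> / 2 * real L - 1) < 1"
        and clique: "\<forall>S\<subseteq>{1..n}. (\<forall>e\<in>all_pairs S. y e) \<longrightarrow> card S \<le> K"
        and disc: "\<forall>S\<subseteq>{1..n}. \<forall>T\<subseteq>{1..n}. \<delta> * real n \<le> real (card S) \<longrightarrow>
          \<bar>\<Sum>v\<in>S. \<Sum>u\<in>T - {v}. of_bool (y {u, v}) - real n powr (- (1 - \<beta>))\<bar>
            < (2 + 2 / \<delta>) * real n powr (\<beta> / 2) * real (card S)"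
      let ?q = "real n powr (- (1 - \<beta>))" and ?V = "{1..n}"
      let ?E = "complement_graph ?V y"
      define s where "s = C * real n powr (\<beta> / 2)"
      have n1: "real n powr (\<beta> / 2) \<ge> 1" using n \<beta> by (simp add: ge_one_powr_ge_zero)
      have s: "s > 0" unfolding s_def using C n1 by (intro mult_pos_pos) linarith+
      obtain Ps where Ps: "multiset_coloring ?V ?E Ps" "length Ps = multiset_chromatic_number ?V ?E"
        using ex_coloring_of_chromatic_number[OF _ complement_graph_subset] by (metis finite_atLeastAtMost)
      show "2 / \<beta> \<le> real (multiset_chromatic_number ?V ?E)"
      proof (rule ccontr)
        assume "\<not> ?thesis"
        then have "real (length Ps) < 2 / \<beta>" using Ps(2) by simp
        then have "int (length Ps) < \<lceil>2 / \<beta>\<rceil>" by (simp add: less_ceiling_iff)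
        then have len: "length Ps \<le> L" unfolding L_def by linarith
        have "real (card ?V) \<le> 2 * real K * (2 * (s + 1) + 1) ^ length Ps"
        proof (rule card_le_of_multiset_coloring[OF _ complement_graph_subset Ps(1)])
          fix S assume S: "S \<subseteq> ?V" "\<And>u v. u \<in> S \<Longrightarrow> v \<in> S \<Longrightarrow> {u, v} \<notin> ?E"
          have "y e" if e: "e \<in> all_pairs S" for e
          proof -
            obtain u v where "e = {u, v}" using e by (auto simp: all_pairs_def card_2_iff)
            moreover have "e \<in> all_pairs ?V" using e all_pairs_mono[OF S(1)] by blast
            ultimately show ?thesis
              using e S(2)[of u v] by (simp add: complement_graph_def pair_mem_all_pairs)
          qed
          then show "card S \<le> K" using clique S by blast
        next
          fix T assume T: "T \<subseteq> ?V"
          have "real (card {v\<in>?V. \<bar>real (card (neighborhood ?E v \<inter> T)) - (1 - ?q) * real (card T)\<bar> > s + 1})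
            \<le> 2 * \<delta> * real (card ?V)"
          proof (rule degree_deviation_set_small[OF _ _ _ T])
            fix S assume "S \<subseteq> ?V" "\<delta> * real (card ?V) \<le> real (card S)"
            then show "\<bar>\<Sum>v\<in>S. \<Sum>u\<in>T - {v}. of_bool (y {u, v}) - ?q\<bar> < s * real (card S)"
              using disc T by (simp add: s_def C_def)
          qed (use sparse_rate[OF \<beta>(2) n] \<delta> n in auto)
          then have "real (length Ps) * real (card {v\<in>?V. \<bar>real (card (neighborhood ?E v \<inter> T)) - (1 - ?q) * real (card T)\<bar> > s + 1})
            \<le> (real L + 1) * (2 * \<delta> * real (card ?V))"
            using len by (intro mult_mono) auto
          also have "\<dots> = real (card ?V) / 2" by (simp add: \<delta>_def field_simps)
          finally show "real (length Ps) * real (card {v\<in>?V. \<bar>real (card (neighborhood ?E v \<inter> T)) - (1 - ?q) * real (card T)\<bar> > s + 1})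
            \<le> real (card ?V) / 2" .
        qed (use s in auto)
        also have "\<dots> \<le> 2 * real K * (2 * (s + 1) + 1) ^ L"
          using len s by (intro mult_left_mono power_increasing) auto
        \<comment> \<open>The window count is 2C n^(\<beta>/2) + 3, and n^(\<beta>/2) \<ge> 1
          absorbs the 3.\<close>
        also have "\<dots> \<le> 2 * real K * ((2 * C + 3) * real n powr (\<beta> / 2)) ^ L"
          using n1 s by (intro mult_left_mono power_mono) (auto simp: s_def algebra_simps)
        also have "\<dots> = 2 * real K * (2 * C + 3) ^ L * real n powr (\<beta> / 2 * real L)"
          using n by (simp add: power_mult_distrib powr_realpow[symmetric] powr_powr)
        also have "real n powr (\<beta> / 2 * real L) = real n powr (\<beta> / 2 * real L - 1) * real n"
          using n by (simp add: powr_diff)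
        also have "2 * real K * (2 * C + 3) ^ L * (real n powr (\<beta> / 2 * real L - 1) * real n)
          = (2 * real K * (2 * C + 3) ^ L * real n powr (\<beta> / 2 * real L - 1)) * real n" by simp
        also have "\<dots> < 1 * real n" using small n by (intro mult_strict_right_mono) auto
        finally show False by simp
      qed
    qed
  qed
qed

lemma whp_upper_bound:
  fixes \<beta> :: real
  assumes \<beta>: "0 < \<beta>" "\<beta> < 1"
  shows "whp (sparse_pmf \<beta>) (\<lambda>n y.
    int (multiset_chromatic_number {1..n} (complement_graph {1..n} y)) \<le> \<lfloor>2 / \<beta>\<rfloor> + 5)"
proof -
  define r where "r = nat (\<lfloor>2 / \<beta>\<rfloor> + 4)"
  have fl: "\<lfloor>2 / \<beta>\<rfloor> \<ge> 0" using \<beta> by simp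
  then have ri: "int r = \<lfloor>2 / \<beta>\<rfloor> + 4" and r0: "r > 0" unfolding r_def by linarith+
  have "real r = of_int \<lfloor>2 / \<beta>\<rfloor> + 4" using ri by (metis of_int_add of_int_numeral of_int_of_nat_eq)
  then have rr: "real r > 2 / \<beta> + 3" by linarith
  \<comment> \<open>Consecutive blocks of length \<open>n div r\<close>. They are fixed before the
    graph is sampled, so degrees into them obey the tail bounds.\<close>
  define A where "A = (\<lambda>n i. {i * (n div r)<..Suc i * (n div r)})"
  have Adisj: "disjoint_family_on (A n) {..<r}" for n
  proof -
    have "A n i \<inter> A n j = {}" if "i < j" for i j
    proof -
      have "Suc i * (n div r) \<le> j * (n div r)" using that by (intro mult_right_mono) auto
      then show ?thesis by (auto simp: A_def)
    qed
    then show ?thesis unfolding disjoint_family_on_def by (metis Int_commute linorder_neqE_nat)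
  qed
  have AV: "A n i \<subseteq> {1..n}" if "i < r" for n i
  proof -
    have "Suc i * (n div r) \<le> r * (n div r)" using that by (intro mult_right_mono) auto
    also have "\<dots> \<le> n" by simp
    finally show ?thesis by (auto simp: A_def)
  qed
  have Acard: "real (card (A n i)) \<ge> real n / real r - 1" for n i
  proof -
    have "card (A n i) = n div r" by (simp add: A_def)
    moreover have "real n / real r < real (n div r) + 1"
      using dividend_less_div_times[OF r0, of n] r0
      by (simp add: field_simps flip: of_nat_mult of_nat_add)
    ultimately show ?thesis by linarith
  qed
  \<comment> \<open>Then c n^\<beta> is a quarter of the guaranteed block degree n^\<beta>/(4r).
    Removing that much and one more vertex leaves at least m = 2c n^\<beta>, provided c n^\<beta>
    \<ge> 1.\<close>
  define c where "c = 1 / (16 * real r)"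
  have c: "c > 0" using r0 by (simp add: c_def)
  \<comment> \<open>The exponent in the local lemma condition: 2\<beta> from \<Delta>^2, 1 -
    \<beta>/2 from the degree classes and -r\<beta>/2 from the collision probability.\<close>
  define \<gamma> where "\<gamma> = 1 + 3 / 2 * \<beta> - \<beta> / 2 * real r"
  have "\<beta> / 2 * (2 / \<beta> + 3) < \<beta> / 2 * real r" using rr \<beta> by (intro mult_strict_left_mono) auto
  then have \<gamma>: "\<gamma> < 0" using \<beta> by (simp add: \<gamma>_def algebra_simps)
  \<comment> \<open>Here 16 is the local lemma constant, 9 comes from \<Delta> = 3n^\<beta>, 55 from
    \<open>D\<close>, and 6/sqrt(m/2) = 24 sqrt r n^(-\<beta>/2).\<close>
  define Z where "Z = 16 * 9 * 55 * (24 * sqrt (real r)) ^ r"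
  have "(\<lambda>n. Z * real n powr \<gamma>) \<longlonglongrightarrow> Z * 0"
    by (intro tendsto_mult tendsto_const tendsto_neg_powr \<gamma> filterlim_real_sequentially)
  then have ev: "eventually (\<lambda>n. Z * real n powr \<gamma> < 1) sequentially"
    by (intro order_tendstoD(2)) auto
  have ev2: "eventually (\<lambda>n. real n powr \<beta> \<ge> 16 * real r) sequentially"
    using powr_pos_at_top[OF \<beta>(1)] by (simp add: filterlim_at_top)
  show ?thesis
  proof (rule whp_mono[OF whp_conj[OF whp_conj[OF whp_degree_upper[OF \<beta>] whp_degree_lower[OF \<beta> r0 AV Acard]]
        whp_conj[OF whp_codegree[OF \<beta> c] whp_degree_classes[OF \<beta>]]]])
    show "eventually (\<lambda>n. \<forall>y.
      ((\<forall>u\<in>{1..n}. real (card {w \<in> {1..n} - {u}. y {u, w}}) < 2 * real n powr \<beta>) \<and>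
       (\<forall>u\<in>{1..n}. \<forall>i<r. real n powr \<beta> / (4 * real r) < real (card {w \<in> A n i - {u}. y {u, w}}))) \<and>
      (\<forall>u\<in>{1..n}. \<forall>v\<in>{1..n}. u \<noteq> v \<longrightarrow>
         real (card {w \<in> {1..n} - {u, v}. y {u, w} \<and> y {v, w}}) < c * real n powr \<beta>) \<and>
      (\<forall>k. real (card {v\<in>{1..n}. card {w \<in> {1..n} - {v}. y {v, w}} = k}) < 54 * real n powr (1 - \<beta> / 2) + 1)
      \<longrightarrow> int (multiset_chromatic_number {1..n} (complement_graph {1..n} y)) \<le> \<lfloor>2 / \<beta>\<rfloor> + 5) sequentially"
      using eventually_ge_at_top[of 1] ev ev2
    proof (eventually_elim, intro allI impI, elim conjE)
      fix n :: nat and y :: "nat set \<Rightarrow> bool"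
      let ?V = "{1..n}"
      let ?E = "complement_graph ?V y"
      let ?M = "nonneighborhood ?V ?E"
      assume n: "1 \<le> n" and small: "Z * real n powr \<gamma> < 1" and nb: "16 * real r \<le> real n powr \<beta>"
        and up: "\<forall>u\<in>?V. real (card {w \<in> ?V - {u}. y {u, w}}) < 2 * real n powr \<beta>"
        and lo: "\<forall>u\<in>?V. \<forall>i<r. real n powr \<beta> / (4 * real r) < real (card {w \<in> A n i - {u}. y {u, w}})"
        and co: "\<forall>u\<in>?V. \<forall>v\<in>?V. u \<noteq> v \<longrightarrow>
         real (card {w \<in> ?V - {u, v}. y {u, w} \<and> y {v, w}}) < c * real n powr \<beta>"
        and cl: "\<forall>k. real (card {v\<in>?V. card {w \<in> ?V - {v}. y {v, w}} = k}) < 54 * real n powr (1 - \<beta> / 2) + 1"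
      have M: "?M v = insert v {w \<in> ?V - {v}. y {v, w}}" if "v \<in> ?V" for v
        using that by (rule nonneighborhood_complement_graph)
      have cM: "card (?M v) = Suc (card {w \<in> ?V - {v}. y {v, w}})" if "v \<in> ?V" for v
        unfolding M[OF that] by (subst card_insert_disjoint) auto
      define m where "m = real n powr \<beta> / (8 * real r)"
      have nb1: "real n powr \<beta> \<ge> 1" using nb r0 by linarith
      have n2: "real n powr (1 - \<beta> / 2) \<ge> 1" using n \<beta> by (simp add: ge_one_powr_ge_zero)
      have "multiset_chromatic_number ?V ?E \<le> r + 1"
      proof (rule multiset_chromatic_number_le_of_regularity[where A = "A n" and
            \<Delta> = "3 * real n powr \<beta>" and D = "55 * real n powr (1 - \<beta> / 2)" and m = m])
        show "real (card (?M u)) \<le> 3 * real n powr \<beta>" if "u \<in> ?V" for u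
          using cM[OF that] up nb1 that by fastforce
        show "m > 0" unfolding m_def using n r0 by simp
        show "real (card {v\<in>?V. card (?M v) = k}) \<le> 55 * real n powr (1 - \<beta> / 2)" for k
        proof -
          \<comment> \<open>The shift by one appears because \<open>?M v\<close> contains
            \<open>v\<close>; for \<open>k = 0\<close> the left side is empty.\<close>
          have "{v\<in>?V. card (?M v) = k} \<subseteq> {v\<in>?V. card {w \<in> ?V - {v}. y {v, w}} = k - 1}"
            using cM by auto
          then have "card {v\<in>?V. card (?M v) = k} \<le> card {v\<in>?V. card {w \<in> ?V - {v}. y {v, w}} = k - 1}"
            by (intro card_mono) auto
          then have "real (card {v\<in>?V. card (?M v) = k}) \<le> real (card {v\<in>?V. card {w \<in> ?V - {v}. y {v, w}} = k - 1})"
            by (rule of_nat_mono)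
          also have "\<dots> < 54 * real n powr (1 - \<beta> / 2) + 1" using cl by blast
          finally show ?thesis using n2 by linarith
        qed
        show "m \<le> real (card (?M u \<inter> A n i - ?M v))" if e: "{u, v} \<in> ?E" and i: "i < r" for u v i
        proof -
          have uv: "u \<in> ?V" "v \<in> ?V" "u \<noteq> v"
            using subsetD[OF complement_graph_subset e] unfolding pair_mem_all_pairs by blast+
          let ?X = "{w \<in> A n i - {u}. y {u, w}}" and ?Y = "{w \<in> ?V - {u, v}. y {u, w} \<and> y {v, w}}"
          have finX: "finite ?X" by (simp add: A_def)
          \<comment> \<open>A non-neighbour of \<open>u\<close> in the block is lost only if
            \<open>?M v\<close> contains it too: then it is a common non-neighbour in
            \<open>?Y\<close>, or \<open>v\<close>, which belongs to its own
            \<open>?M v\<close>.\<close>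
          have "?X \<subseteq> (?M u \<inter> A n i - ?M v) \<union> insert v ?Y"
            unfolding M[OF uv(1)] M[OF uv(2)] using AV[OF i, of n] by auto
          then have "card ?X \<le> card ((?M u \<inter> A n i - ?M v) \<union> insert v ?Y)"
            by (intro card_mono) (auto simp: A_def)
          also have "\<dots> \<le> card (?M u \<inter> A n i - ?M v) + card (insert v ?Y)" by (rule card_Un_le)
          also have "card (insert v ?Y) \<le> Suc (card ?Y)" by (simp add: card_insert_if)
          finally have "real (card ?X) \<le> real (card (?M u \<inter> A n i - ?M v)) + 1 + real (card ?Y)" by linarith
          moreover have "real (card ?X) > real n powr \<beta> / (4 * real r)" using lo uv i by blast
          moreover have "real (card ?Y) < c * real n powr \<beta>" using co uv by blast
          moreover have "real n powr \<beta> / (4 * real r) = 4 * (c * real n powr \<beta>)" "m = 2 * (c * real n powr \<beta>)"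
            using r0 by (auto simp: m_def c_def)
          moreover have "c * real n powr \<beta> \<ge> 1" using nb r0 by (simp add: c_def field_simps)
          ultimately show ?thesis by linarith
        qed
        show "16 * (3 * real n powr \<beta>)\<^sup>2 * (55 * real n powr (1 - \<beta> / 2)) * (6 / sqrt (m * (1 / 2))) ^ r \<le> 1"
        proof -
          have "sqrt (m * (1/2)) = sqrt (real n powr \<beta> / (16 * real r))" by (simp add: m_def)
          also have "\<dots> = real n powr (\<beta> / 2) / (4 * sqrt (real r))"
            using n by (simp add: real_sqrt_divide real_sqrt_mult powr_half_sqrt[symmetric] powr_powr)
          finally have "6 / sqrt (m * (1/2)) = 24 * sqrt (real r) * real n powr (- (\<beta> / 2))"
            by (simp add: powr_minus field_simps)
          then have p: "(6 / sqrt (m * (1/2))) ^ r = (24 * sqrt (real r)) ^ r * real n powr (- (\<beta> / 2) * real r)"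
            using n by (simp add: power_mult_distrib powr_realpow[symmetric] powr_powr)
          have q: "(3 * real n powr \<beta>)\<^sup>2 = 9 * real n powr (2 * \<beta>)"
            by (simp add: power2_eq_square powr_add[symmetric])
          have "real n powr (2 * \<beta>) * real n powr (1 - \<beta> / 2) * real n powr (- (\<beta> / 2) * real r)
            = real n powr \<gamma>"
            by (simp add: powr_add[symmetric] \<gamma>_def algebra_simps)
          moreover have "16 * (3 * real n powr \<beta>)\<^sup>2 * (55 * real n powr (1 - \<beta> / 2)) * (6 / sqrt (m * (1 / 2))) ^ r
            = Z * (real n powr (2 * \<beta>) * real n powr (1 - \<beta> / 2) * real n powr (- (\<beta> / 2) * real r))"
            unfolding p q Z_def by (simp add: mult_ac)
          ultimately show ?thesis using small by simp
        qed
      qed (use Adisj AV nb1 n2 in \<open>auto simp: complement_graph_subset\<close>)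
      then show "int (multiset_chromatic_number ?V ?E) \<le> \<lfloor>2 / \<beta>\<rfloor> + 5" using ri by linarith
    qed
  qed
qed

theorem theorem3p1:
  shows
    "(\<forall>\<beta>::real. 0 < \<beta> \<and> \<beta> < 1 \<longrightarrow>
        (\<lambda>n::nat. measure_pmf.prob (gnp n (1 - real n powr (- (1 - \<beta>))))
            {E. 2 / \<beta> \<le> real (multiset_chromatic_number {1..n} E) \<and>
                int (multiset_chromatic_number {1..n} E) \<le> \<lfloor>2 / \<beta>\<rfloor> + 5})
          \<longlonglongrightarrow> 1)
     \<and> (\<exists>C::real. \<forall>\<beta>::real. 0 < \<beta> \<and> \<beta> < 1 \<longrightarrow>
        (\<lambda>n::nat. measure_pmf.prob (gnp n (1 - real n powr (- (1 - \<beta>))))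
            {E. \<bar>real (multiset_chromatic_number {1..n} E) - 2 / \<beta>\<bar> \<le> C})
          \<longlonglongrightarrow> 1)"
proof -
  let ?M = "\<lambda>\<beta> n. gnp n (1 - real n powr (- (1 - \<beta>)))"
  let ?\<chi> = "\<lambda>n E. multiset_chromatic_number {1..n} E"
  have main: "whp (?M \<beta>) (\<lambda>n E. 2 / \<beta> \<le> real (?\<chi> n E) \<and> int (?\<chi> n E) \<le> \<lfloor>2 / \<beta>\<rfloor> + 5)"
    if "0 < \<beta> \<and> \<beta> < 1" for \<beta> :: real
  proof -
    have \<beta>: "0 < \<beta>" "\<beta> < 1" using that by auto
    let ?P = "\<lambda>n E. 2 / \<beta> \<le> real (?\<chi> n E) \<and> int (?\<chi> n E) \<le> \<lfloor>2 / \<beta>\<rfloor> + 5"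
    have "whp (sparse_pmf \<beta>) (\<lambda>n y. ?P n (complement_graph {1..n} y))"
      by (rule whp_conj[OF whp_lower_bound[OF \<beta>] whp_upper_bound[OF \<beta>]])
    moreover have "eventually (\<lambda>n. measure_pmf.prob (sparse_pmf \<beta> n) {y. ?P n (complement_graph {1..n} y)} =
        measure_pmf.prob (?M \<beta> n) {E. ?P n E}) sequentially"
      using eventually_ge_at_top[of 1]
    proof eventually_elim
      case (elim n)
      have "?M \<beta> n = map_pmf (complement_graph {1..n}) (sparse_pmf \<beta> n)"
        using gnp_eq_complement[of "1 - real n powr (- (1 - \<beta>))" n] sparse_rate[OF \<beta>(2) elim]
        by (simp add: sparse_pmf_def)
      then show ?case by (simp add: vimage_def)
    qed
    ultimately show ?thesis
      unfolding whp_def by (rule Lim_transform_eventually)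
  qed
  \<comment> \<open>The value 5 serves every \<beta>, so the constant is absolute: rounding
    2/\<beta> down only lowers the upper bound.\<close>
  have "whp (?M \<beta>) (\<lambda>n E. \<bar>real (?\<chi> n E) - 2 / \<beta>\<bar> \<le> 5)" if "0 < \<beta> \<and> \<beta> < 1" for \<beta> :: real
  proof (rule whp_mono[OF main[OF that]], intro always_eventually allI impI, elim conjE)
    fix n and E :: "nat set set"
    assume lo: "2 / \<beta> \<le> real (?\<chi> n E)" and up: "int (?\<chi> n E) \<le> \<lfloor>2 / \<beta>\<rfloor> + 5"
    have "real (?\<chi> n E) \<le> of_int (\<lfloor>2 / \<beta>\<rfloor> + 5)" using up by linarith
    then show "\<bar>real (?\<chi> n E) - 2 / \<beta>\<bar> \<le> 5" using lo by linarith
  qed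
  with main show ?thesis unfolding whp_def by blast
qed

end
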